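(* Let $X$ be a geometric distance-regular graph of diameter $d\geq 2$ with smallest eigenvalue $-m$, vertex degree $k$ and second largest eigenvalue $\theta_1$. Suppose that $\mu\geq 2$ and $\theta_1\geq (1-\varepsilon)b_1$, where $0<\varepsilon<1/(6m^4d)$. Moreover, assume that $c_t\leq \varepsilon k$ and $b_t\leq \varepsilon k$ for some $t\leq d$, and that the neighborhood graph $X(v)$ is disconnected for some vertex $v$ of $X$. Then $X$ is the Hamming graph $H(d,s)$ with $s=1+k/d$.
   Context: A connected graph $X$ of diameter $d$ is distance-regular if for each $0\le i\le d$ there are constants $a_i,b_i,c_i$ such that for any vertices $v,w$ with $\mathrm{dist}(v,w)=i$, $w$ has exactly $c_i$ neighbors at distance $i-1$ from $v$, $a_i$ at distance $i$, and $b_i$ at distance $i+1$; $k=b_0$, $\lambda=a_1$, $\mu=c_2$. Its distinct adjacency eigenvalues are $k=\theta_0>\theta_1>\dots>\theta_d$. $X(v)$ is the subgraph induced on the neighbors of $v$. A Delsarte clique is a clique of size $1-k/\theta_d$; $X$ is geometric if there is a collection of Delsarte cliques such that every edge lies in exactly one of them. The Hamming graph $H(d,s)$ has vertex set $\Omega^d$ with $|\Omega|=s$, two $d$-tuples adjacent iff they differ in exactly one coordinate. *)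

theory Defs
  imports
    "Graph_Theory.Digraph_Component"
    "Graph_Theory.Digraph_Isomorphism"
    "Graph_Theory.Shortest_Path"
    "Jordan_Normal_Form.Char_Poly"
begin

(* Finite simple graphs are the symmetric loop-free digraphs of the locale pair_graph. *)

abbreviation neighbors :: "'a pair_pre_digraph \<Rightarrow> 'a \<Rightarrow> 'a set" where
  "neighbors X v \<equiv> {u. (v, u) \<in> parcs X}"

definition neighborhood_graph :: "'a pair_pre_digraph \<Rightarrow> 'a \<Rightarrow> ('a, 'a \<times> 'a) pre_digraph" where
  "neighborhood_graph X v = with_proj X \<restriction> neighbors X v"

(* Unit arc weights, so the minimum cost of a walk is the minimum number of arcs. *)
definition graph_dist :: "'a pair_pre_digraph \<Rightarrow> 'a \<Rightarrow> 'a \<Rightarrow> ereal" where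
  "graph_dist X u v = wf_digraph.\<mu> (with_proj X) (\<lambda>_. 1) u v"

definition diameter :: "'a pair_pre_digraph \<Rightarrow> ereal" where
  "diameter X = (SUP (u, v) \<in> pverts X \<times> pverts X. graph_dist X u v)"

(* The condition dist v u + 1 = i is dist v u = i - 1 without a negative distance for i = 0;
   it forces c 0 = 0.  Likewise b d = 0. Values of a, b, c beyond d are unconstrained. *)
locale distance_regular_graph = pair_graph X
  for X :: "'a pair_pre_digraph" +
  fixes d :: nat and a b c :: "nat \<Rightarrow> nat"
  assumes connected: "Digraph_Component.connected (with_proj X)"
    and diameter: "diameter X = ereal (real d)"
    and intersection_c:
      "\<lbrakk>i \<le> d; v \<in> pverts X; w \<in> pverts X; graph_dist X v w = ereal (real i)\<rbrakk>
        \<Longrightarrow> card {u \<in> neighbors X w. graph_dist X v u + 1 = ereal (real i)} = c i"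
    and intersection_a:
      "\<lbrakk>i \<le> d; v \<in> pverts X; w \<in> pverts X; graph_dist X v w = ereal (real i)\<rbrakk>
        \<Longrightarrow> card {u \<in> neighbors X w. graph_dist X v u = ereal (real i)} = a i"
    and intersection_b:
      "\<lbrakk>i \<le> d; v \<in> pverts X; w \<in> pverts X; graph_dist X v w = ereal (real i)\<rbrakk>
        \<Longrightarrow> card {u \<in> neighbors X w. graph_dist X v u = ereal (real i) + 1} = b i"

definition adjacency_mat :: "'a pair_pre_digraph \<Rightarrow> 'a list \<Rightarrow> real mat" where
  "adjacency_mat X vs =
    mat (length vs) (length vs) (\<lambda>(i, j). if (vs ! i, vs ! j) \<in> parcs X then 1 else 0)"

(* Matrices are indexed by numbers, so the vertices are enumerated by a list; another enumeration
   conjugates the matrix by a permutation matrix and gives the same eigenvalues. *)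
definition adjacency_spectrum :: "'a pair_pre_digraph \<Rightarrow> real set" where
  "adjacency_spectrum X =
    {\<theta>. \<exists>vs. distinct vs \<and> set vs = pverts X \<and> eigenvalue (adjacency_mat X vs) \<theta>}"

definition smallest_eigenvalue :: "'a pair_pre_digraph \<Rightarrow> real" where
  "smallest_eigenvalue X = Min (adjacency_spectrum X)"

(* Second largest among the distinct eigenvalues. *)
definition second_largest_eigenvalue :: "'a pair_pre_digraph \<Rightarrow> real" where
  "second_largest_eigenvalue X = Max (adjacency_spectrum X - {Max (adjacency_spectrum X)})"

definition clique :: "'a pair_pre_digraph \<Rightarrow> 'a set \<Rightarrow> bool" where
  "clique X C \<longleftrightarrow> C \<subseteq> pverts X \<and> (\<forall>u\<in>C. \<forall>v\<in>C. u \<noteq> v \<longrightarrow> (u, v) \<in> parcs X)"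

(* The parameter k is the vertex degree. *)
definition Delsarte_clique :: "'a pair_pre_digraph \<Rightarrow> nat \<Rightarrow> 'a set \<Rightarrow> bool" where
  "Delsarte_clique X k C \<longleftrightarrow>
    clique X C \<and> real (card C) = 1 - real k / smallest_eigenvalue X"

definition geometric :: "'a pair_pre_digraph \<Rightarrow> nat \<Rightarrow> bool" where
  "geometric X k \<longleftrightarrow>
    (\<exists>\<C>. (\<forall>C\<in>\<C>. Delsarte_clique X k C) \<and>
      (\<forall>(u, v) \<in> parcs X. \<exists>!C. C \<in> \<C> \<and> u \<in> C \<and> v \<in> C))"

(* The d-tuples over \<Omega> are the lists of length d. *)
definition Hamming_graph :: "nat \<Rightarrow> 'b set \<Rightarrow> 'b list pair_pre_digraph" where
  "Hamming_graph d \<Omega> =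
    \<lparr>pverts = {xs. length xs = d \<and> set xs \<subseteq> \<Omega>},
     parcs = {(xs, ys). length xs = d \<and> set xs \<subseteq> \<Omega> \<and> length ys = d \<and> set ys \<subseteq> \<Omega> \<and>
       (\<exists>!i. i < d \<and> xs ! i \<noteq> ys ! i)}\<rparr>"

end

theory Submission
  imports Defs "HOL-Analysis.L2_Norm"
begin

text \<open>For every eigenvalue \<open>\<theta>\<close> the vertices are represented by vectors whose inner products
  \<open>u i\<close> depend only on the distance \<open>i\<close>. For \<open>\<theta> = - m\<close> the vectors of a Delsarte clique (a line) sum
  to zero, so the number of neighbours in a line of a vertex at distance one from it is constant. It
  is one because a larger value would make every neighbourhood graph connected; hence a
  neighbourhood is a disjoint union of \<open>m\<close> cliques of size \<open>n = k / m\<close>.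

  For \<open>\<theta> = \<theta>\<^sub>1\<close>, scaled so that adjacent vertices have squared distance 2, an induced quadrangle
  \<open>x, y, w, z\<close> satisfies \<open>\<parallel>x - y + w - z\<parallel>\<^sup>2 = 4 \<eta>\<close> with \<open>\<eta> = 1 - (\<theta>\<^sub>1 + 1) / b\<^sub>1 \<le> \<epsilon>\<close>.
  So quadrangles are almost parallelograms, whereas distinct neighbours of a vertex are far
  apart. Since \<open>c\<^sub>2 \<ge> 2\<close>, two neighbours on different lines span a quadrangle, and an edge can be
  translated along the lines through a base vertex; as the error stays below the minimal distance,
  translations commute exactly. This yields a map from the words of length \<open>m\<close> over \<open>n + 1\<close> letters
  that is a local bijection, hence onto, and injective because the lines through the base vertex
  are almost orthogonal. Comparing diameters gives \<open>m = d\<close>.\<close>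

section \<open>Distances in a distance-regular graph\<close>

lemma Max_attained_SUP_ereal:
  fixes f :: "'b \<Rightarrow> ereal"
  assumes "finite A" "A \<noteq> {}" "(SUP x\<in>A. f x) = c"
  shows "\<exists>x\<in>A. f x = c"
proof -
  have "Sup (f ` A) = Max (f ` A)"
    using assms by (intro cSup_eq_Max) auto
  moreover have "Max (f ` A) \<in> f ` A"
    using assms by (intro Max_in) auto
  ultimately have "c \<in> f ` A"
    using assms by simp
  then show ?thesis
    by auto
qed

context distance_regular_graph
begin

abbreviation "V \<equiv> pverts X"
abbreviation "E \<equiv> parcs X"

lemma V_finite: "finite V"
  by (rule pair_finite_verts)

lemma E_in_V: "(x, y) \<in> E \<Longrightarrow> x \<in> V" "(x, y) \<in> E \<Longrightarrow> y \<in> V"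
  using in_arcsD1 in_arcsD2 by auto

lemma E_sym: "(x, y) \<in> E \<Longrightarrow> (y, x) \<in> E"
  using pair_sym_arcs by (auto simp: symmetric_def dest: symD)

lemma E_irrefl: "(x, x) \<notin> E"
  using pair_no_loops by fastforce

lemma finite_neighbors: "finite (neighbors X x)"
  by (rule finite_subset[OF _ V_finite]) (auto dest: E_in_V)

text \<open>The distance as a natural number, so that inductions on it need no \<open>ereal\<close>;
  \<open>graph_dist_eq\<close> identifies it with \<open>graph_dist\<close> on
  \<open>V\<close>.\<close>

definition gdist :: "'a \<Rightarrow> 'a \<Rightarrow> nat" where
  "gdist x y = (LEAST n. \<exists>p. awalk x p y \<and> length p = n)"

lemma walk_exists: "x \<in> V \<Longrightarrow> y \<in> V \<Longrightarrow> \<exists>p. awalk x p y"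
proof -
  assume "x \<in> V" "y \<in> V"
  moreover have "strongly_connected (with_proj X)"
    using connected symmetric_connected_imp_strongly_connected pair_sym_arcs by blast
  ultimately show ?thesis
    using reachable_awalk by (auto simp: strongly_connected_def)
qed

lemma gdist_walk:
  assumes "x \<in> V" "y \<in> V"
  obtains p where "awalk x p y" "length p = gdist x y"
proof -
  have "\<exists>p. awalk x p y \<and> length p = gdist x y"
    unfolding gdist_def by (rule LeastI_ex) (use walk_exists[OF assms] in auto)
  then show ?thesis
    using that by blast
qed

lemma gdist_le: "awalk x p y \<Longrightarrow> gdist x y \<le> length p"
  unfolding gdist_def by (rule Least_le) blast

lemma graph_dist_eq: 
  assumes "x \<in> V" "y \<in> V"
  shows "graph_dist X x y = ereal (real (gdist x y))"
proof -
  have cost: "awalk_cost (\<lambda>_. 1) p = real (length p)" for p :: "('a \<times> 'a) list"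
    by (induction p) auto
  obtain p where p: "awalk x p y" "length p = gdist x y"
    using gdist_walk assms by blast
  have "graph_dist X x y = (INF p\<in>{p. awalk x p y}. ereal (real (length p)))"
    unfolding graph_dist_def \<mu>_def cost ..
  also have "\<dots> = ereal (real (gdist x y))"
  proof (rule INF_eqI)
    show "y' \<le> ereal (real (gdist x y))" if "\<And>q. q \<in> {p. awalk x p y} \<Longrightarrow> y' \<le> ereal (real (length q))" for y'
      using that[of p] p by simp
  qed (use gdist_le in auto)
  finally show ?thesis .
qed

lemma gdist_self [simp]: "x \<in> V \<Longrightarrow> gdist x x = 0"
  using gdist_le[of x "[]" x] by (simp add: awalk_Nil_iff)

lemma gdist_0D: "x \<in> V \<Longrightarrow> y \<in> V \<Longrightarrow> gdist x y = 0 \<Longrightarrow> x = y"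
  by (rule gdist_walk[of x y]) (auto simp: awalk_Nil_iff)

lemma gdist_step: "x \<in> V \<Longrightarrow> (y, z) \<in> E \<Longrightarrow> gdist x z \<le> Suc (gdist x y)"
proof -
  assume "x \<in> V" and yz: "(y, z) \<in> E"
  then obtain p where p: "awalk x p y" "length p = gdist x y"
    using gdist_walk E_in_V by metis
  have "awalk y [(y, z)] z"
    using arc_implies_awalk[OF yz] by simp
  then have "awalk x (p @ [(y, z)]) z"
    using p by (auto intro: awalk_appendI)
  from gdist_le[OF this] p show ?thesis
    by simp
qed

text \<open>The vertex before the end of a shortest walk; \<open>gdist_step\<close> excludes that it
  lies closer than \<open>n\<close>.\<close>

lemma gdist_pred:
  assumes "x \<in> V" "y \<in> V" "gdist x y = Suc n"
  shows "\<exists>z\<in>V. (z, y) \<in> E \<and> gdist x z = n"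
proof -
  obtain p where p: "awalk x p y" "length p = Suc n"
    using gdist_walk assms by metis
  then obtain q z w where q: "p = q @ [(z, w)]" "length q = n"
    by (cases p rule: rev_cases) auto
  then have w: "awalk x q z" "(z, y) \<in> E"
    using p by (auto simp: awalk_simps)
  then have "gdist x z \<le> n"
    using gdist_le q by blast
  moreover have "Suc n \<le> Suc (gdist x z)"
    using gdist_step[OF assms(1) w(2)] assms(3) by simp
  ultimately show ?thesis
    using w E_in_V by (intro bexI[of _ z]) auto
qed

lemma walk_rev: "awalk x p y \<Longrightarrow> \<exists>q. awalk y q x \<and> length q = length p"
proof (induction p arbitrary: x)
  case Nil
  then show ?case
    by (intro exI[of _ "[]"]) (auto simp: awalk_Nil_iff)
next
  case (Cons e p)
  obtain u v where [simp]: "e = (u, v)"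
    by force
  have e: "(u, v) \<in> E" "u = x" "awalk v p y"
    using Cons.prems by (auto simp: awalk_Cons_iff)
  obtain q where q: "awalk y q v" "length q = length p"
    using Cons.IH e by blast
  have "awalk v [(v, u)] u"
    using arc_implies_awalk[OF E_sym[OF e(1)]] by simp
  then have "awalk y (q @ [(v, u)]) x"
    using q e by (auto intro: awalk_appendI)
  with q show ?case
    by (intro exI[of _ "q @ [(v, u)]"]) auto
qed

lemma gdist_commute: "x \<in> V \<Longrightarrow> y \<in> V \<Longrightarrow> gdist x y = gdist y x"
proof (rule antisym)
  show "gdist x y \<le> gdist y x" if "x \<in> V" "y \<in> V" for x y
  proof -
    obtain p where p: "awalk y p x" "length p = gdist y x"
      using gdist_walk \<open>x \<in> V\<close> \<open>y \<in> V\<close> by metis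
    then show ?thesis
      using walk_rev[OF p(1)] gdist_le by metis
  qed
  then show "gdist y x \<le> gdist x y" if "x \<in> V" "y \<in> V"
    using that by blast
qed

lemma gdist_1_iff: "x \<in> V \<Longrightarrow> y \<in> V \<Longrightarrow> gdist x y = 1 \<longleftrightarrow> (x, y) \<in> E"
proof
  assume "x \<in> V" "y \<in> V" "gdist x y = 1"
  then show "(x, y) \<in> E"
    using gdist_pred[of x y 0] gdist_0D by auto
next
  assume "x \<in> V" "y \<in> V" "(x, y) \<in> E"
  then show "gdist x y = 1"
    using gdist_step[of x x y] gdist_0D[of x y] E_irrefl by fastforce
qed

lemma gdist_2_iff:
  assumes "x \<in> V" "y \<in> V"
  shows "gdist x y = 2 \<longleftrightarrow> x \<noteq> y \<and> (x, y) \<notin> E \<and> (\<exists>z. (x, z) \<in> E \<and> (z, y) \<in> E)"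
proof
  assume 2: "gdist x y = 2"
  then obtain z where "z \<in> V" "(z, y) \<in> E" "gdist x z = 1"
    using gdist_pred[OF assms, of 1] by auto
  then show "x \<noteq> y \<and> (x, y) \<notin> E \<and> (\<exists>z. (x, z) \<in> E \<and> (z, y) \<in> E)"
    using 2 assms gdist_1_iff[of x y] gdist_1_iff[of x z] by auto
next
  assume a: "x \<noteq> y \<and> (x, y) \<notin> E \<and> (\<exists>z. (x, z) \<in> E \<and> (z, y) \<in> E)"
  then obtain z where z: "(x, z) \<in> E" "(z, y) \<in> E" by blast
  then have "gdist x y \<le> 2"
    using gdist_step[OF assms(1) z(2)] gdist_1_iff[of x z] assms E_in_V by auto
  moreover have "gdist x y \<noteq> 0" "gdist x y \<noteq> 1"
    using a gdist_0D gdist_1_iff assms by auto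
  ultimately show "gdist x y = 2"
    by linarith
qed

lemma V_nonempty: "V \<noteq> {}"
  using connected by (auto simp: Digraph_Component.connected_def strongly_connected_def mk_symmetric_def)

lemma gdist_le_d: "x \<in> V \<Longrightarrow> y \<in> V \<Longrightarrow> gdist x y \<le> d"
proof -
  assume "x \<in> V" "y \<in> V"
  then have "graph_dist X x y \<le> ereal (real d)"
    unfolding diameter[symmetric] diameter_def by (intro SUP_upper2[of "(x, y)"]) auto
  then show ?thesis
    using \<open>x \<in> V\<close> \<open>y \<in> V\<close> by (simp add: graph_dist_eq)
qed

lemma gdist_d_attained: "\<exists>x\<in>V. \<exists>y\<in>V. gdist x y = d"
proof -
  have "\<exists>p\<in>V \<times> V. (case p of (u, v) \<Rightarrow> graph_dist X u v) = ereal (real d)"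
    using diameter V_finite V_nonempty unfolding diameter_def
    by (intro Max_attained_SUP_ereal) auto
  then show ?thesis
    by (auto simp: graph_dist_eq)
qed

section \<open>Intersection numbers over the natural-number distance\<close>

lemma card_c:
  assumes "x \<in> V" "y \<in> V" "gdist x y = Suc i"
  shows "card {z. (y, z) \<in> E \<and> gdist x z = i} = c (Suc i)"
proof -
  have "{u \<in> neighbors X y. graph_dist X x u + 1 = ereal (real (Suc i))} =
      {z. (y, z) \<in> E \<and> gdist x z = i}"
    using assms E_in_V by (auto simp: graph_dist_eq one_ereal_def)
  then show ?thesis
    using intersection_c[of "Suc i" x y] assms gdist_le_d[of x y] by (simp add: graph_dist_eq)
qed

lemma card_a:
  assumes "x \<in> V" "y \<in> V" "gdist x y = i"
  shows "card {z. (y, z) \<in> E \<and> gdist x z = i} = a i"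
proof -
  have "{u \<in> neighbors X y. graph_dist X x u = ereal (real i)} =
      {z. (y, z) \<in> E \<and> gdist x z = i}"
    using assms E_in_V by (auto simp: graph_dist_eq one_ereal_def)
  then show ?thesis
    using intersection_a[of i x y] assms gdist_le_d[of x y] by (simp add: graph_dist_eq)
qed

lemma card_b:
  assumes "x \<in> V" "y \<in> V" "gdist x y = i"
  shows "card {z. (y, z) \<in> E \<and> gdist x z = Suc i} = b i"
proof -
  have "{u \<in> neighbors X y. graph_dist X x u = ereal (real i) + 1} =
      {z. (y, z) \<in> E \<and> gdist x z = Suc i}"
    using assms E_in_V by (auto simp: graph_dist_eq one_ereal_def)
  then show ?thesis
    using intersection_b[of i x y] assms gdist_le_d[of x y] by (simp add: graph_dist_eq)
qed

lemma degree: "x \<in> V \<Longrightarrow> card (neighbors X x) = b 0"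
proof -
  assume x: "x \<in> V"
  have "neighbors X x = {z. (x, z) \<in> E \<and> gdist x z = Suc 0}"
    using x E_in_V gdist_1_iff by auto
  then show ?thesis
    using card_b[of x x 0] x by simp
qed

section \<open>Eigenvalues and representations\<close>

definition eigenfunction :: "real \<Rightarrow> ('a \<Rightarrow> real) \<Rightarrow> bool" where
  "eigenfunction \<theta> f \<longleftrightarrow> (\<forall>x\<in>V. (\<Sum>y\<in>neighbors X x. f y) = \<theta> * f x)"

definition sphere :: "nat \<Rightarrow> 'a \<Rightarrow> 'a set" where
  "sphere i x = {y \<in> V. gdist x y = i}"

lemma finite_sphere: "finite (sphere i x)"
  using V_finite by (simp add: sphere_def)

text \<open>Entries of the tridiagonal intersection matrix: for a vertex at distance
  \<open>l\<close> from \<open>x\<close>, the number of its neighbours at distance \<open>i\<close>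
  from \<open>x\<close>.\<close>

definition int_num :: "nat \<Rightarrow> nat \<Rightarrow> nat" where
  "int_num i l = (if i = Suc l then b l else if i = l then a l else if l = Suc i then c l else 0)"

lemma card_int_num:
  assumes "x \<in> V" "z \<in> V"
  shows "card {y. (z, y) \<in> E \<and> gdist x y = i} = int_num i (gdist x z)"
proof -
  have none: "card {y. (z, y) \<in> E \<and> gdist x y = i} = 0"
    if "i \<noteq> Suc (gdist x z)" "i \<noteq> gdist x z" "gdist x z \<noteq> Suc i"
  proof -
    have "gdist x y \<noteq> i" if y: "(z, y) \<in> E" for y
      using gdist_step[OF assms(1) y] gdist_step[OF assms(1) E_sym[OF y]]
        \<open>i \<noteq> Suc (gdist x z)\<close> \<open>i \<noteq> gdist x z\<close> \<open>gdist x z \<noteq> Suc i\<close> by linarith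
    then have "{y. (z, y) \<in> E \<and> gdist x y = i} = {}"
      by blast
    then show ?thesis
      by (metis card.empty)
  qed
  consider "i = Suc (gdist x z)" | "i = gdist x z" | "gdist x z = Suc i"
    | "i \<noteq> Suc (gdist x z)" "i \<noteq> gdist x z" "gdist x z \<noteq> Suc i"
    by blast
  then show ?thesis
  proof cases
    case 1
    then show ?thesis
      using card_b[OF assms refl] by (simp only: int_num_def if_True simp_thms)
  next
    case 2
    then show ?thesis
      using card_a[OF assms refl] by (simp add: int_num_def)
  next
    case 3
    then show ?thesis
      using card_c[OF assms 3] by (simp add: int_num_def)
  next
    case 4
    then show ?thesis
      unfolding none[OF 4] by (simp add: int_num_def)
  qed
qed

lemma sum_by_distance:
  fixes f :: "'a \<Rightarrow> real"
  assumes "x \<in> V"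
  shows "(\<Sum>y\<in>V. g (gdist x y) * f y) = (\<Sum>i\<le>d. g i * (\<Sum>y\<in>sphere i x. f y))"
proof -
  have "(\<Sum>y\<in>V. g (gdist x y) * f y) = (\<Sum>i\<le>d. \<Sum>y\<in>{y\<in>V. gdist x y = i}. g (gdist x y) * f y)"
    using V_finite gdist_le_d[OF assms] by (intro sum.group[symmetric]) auto
  also have "\<dots> = (\<Sum>i\<le>d. g i * (\<Sum>y\<in>sphere i x. f y))"
    by (auto simp: sphere_def sum_distrib_left intro!: sum.cong)
  finally show ?thesis .
qed

lemma sum_neighbors_by_distance:
  fixes g :: "nat \<Rightarrow> real"
  assumes "x \<in> V" "z \<in> V"
  shows "(\<Sum>y\<in>neighbors X z. g (gdist x y)) = (\<Sum>i\<le>d. int_num i (gdist x z) * g i)"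
proof -
  have "(\<Sum>y\<in>neighbors X z. g (gdist x y)) =
      (\<Sum>i\<le>d. \<Sum>y\<in>{y\<in>neighbors X z. gdist x y = i}. g (gdist x y))"
    using finite_neighbors gdist_le_d[OF assms(1)] E_in_V by (intro sum.group[symmetric]) auto
  also have "\<dots> = (\<Sum>i\<le>d. int_num i (gdist x z) * g i)"
  proof (intro sum.cong refl)
    fix i
    have "(\<Sum>y\<in>{y\<in>neighbors X z. gdist x y = i}. g (gdist x y)) =
        (\<Sum>y\<in>{y. (z, y) \<in> E \<and> gdist x y = i}. g i)"
      by (intro sum.cong) auto
    then show "(\<Sum>y\<in>{y\<in>neighbors X z. gdist x y = i}. g (gdist x y)) = int_num i (gdist x z) * g i"
      by (simp add: card_int_num[OF assms])
  qed
  finally show ?thesis .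
qed

text \<open>The eigenvalue equation replaces each vertex of the sphere by its neighbours; after
  swapping the sums a vertex \<open>z\<close> is counted once for each of its neighbours in the
  sphere.\<close>

lemma sphere_sum_recurrence:
  fixes \<theta> :: real and f :: "'a \<Rightarrow> real"
  assumes f: "eigenfunction \<theta> f" and x: "x \<in> V"
  shows "\<theta> * (\<Sum>y\<in>sphere i x. f y) = (\<Sum>l\<le>d. int_num i l * (\<Sum>y\<in>sphere l x. f y))"
proof -
  have "\<theta> * (\<Sum>y\<in>sphere i x. f y) = (\<Sum>y\<in>sphere i x. \<Sum>z\<in>neighbors X y. f z)"
    using f unfolding sum_distrib_left eigenfunction_def
    by (intro sum.cong) (auto simp: sphere_def)
  also have "\<dots> = (\<Sum>y\<in>sphere i x. \<Sum>z\<in>{z\<in>V. (y, z) \<in> E}. f z)"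
    by (intro sum.cong refl) (auto dest: E_in_V)
  also have "\<dots> = (\<Sum>z\<in>V. \<Sum>y\<in>{y\<in>sphere i x. (y, z) \<in> E}. f z)"
    by (rule sum.swap_restrict[OF finite_sphere V_finite])
  also have "\<dots> = (\<Sum>z\<in>V. int_num i (gdist x z) * f z)"
  proof (intro sum.cong refl)
    fix z assume z: "z \<in> V"
    have "{y \<in> sphere i x. (y, z) \<in> E} = {y. (z, y) \<in> E \<and> gdist x y = i}"
      using E_sym E_in_V by (auto simp: sphere_def)
    then show "(\<Sum>y\<in>{y \<in> sphere i x. (y, z) \<in> E}. f z) = int_num i (gdist x z) * f z"
      using card_int_num[OF x z] by simp
  qed
  also have "\<dots> = (\<Sum>l\<le>d. int_num i l * (\<Sum>y\<in>sphere l x. f y))"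
    using x by (rule sum_by_distance)
  finally show ?thesis .
qed

lemma distance_attained: "i \<le> d \<Longrightarrow> \<exists>x\<in>V. \<exists>y\<in>V. gdist x y = i"
proof (induction rule: inc_induct)
  case base
  show ?case
    by (rule gdist_d_attained)
next
  case (step i)
  then obtain x y where "x \<in> V" "y \<in> V" "gdist x y = Suc i"
    by blast
  then show ?case
    using gdist_pred by metis
qed

lemma c_pos: "Suc i \<le> d \<Longrightarrow> c (Suc i) > 0"
proof -
  assume "Suc i \<le> d"
  then obtain x y where xy: "x \<in> V" "y \<in> V" "gdist x y = Suc i"
    using distance_attained by blast
  then obtain z where "(z, y) \<in> E" "gdist x z = i"
    using gdist_pred by blast
  then have "z \<in> {z. (y, z) \<in> E \<and> gdist x z = i}"
    using E_sym by blast
  moreover have "finite {z. (y, z) \<in> E \<and> gdist x z = i}"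
    by (rule finite_subset[OF _ finite_neighbors[of y]]) auto
  ultimately show ?thesis
    unfolding card_c[OF xy, symmetric] by (auto simp: card_gt_0_iff)
qed

lemma sphere_empty: "x \<in> V \<Longrightarrow> i > d \<Longrightarrow> sphere i x = {}"
  using gdist_le_d by (fastforce simp: sphere_def)

text \<open>The recurrence for the sphere of radius \<open>i - 1\<close> contains the sphere of
  radius \<open>i\<close> with coefficient \<open>c i > 0\<close>, so it determines that sum from
  the smaller spheres, by a factor independent of \<open>f\<close> and \<open>x\<close>.\<close>

lemma sphere_sum_ex:
  "\<exists>q. \<forall>f x. eigenfunction \<theta> f \<longrightarrow> x \<in> V \<longrightarrow> (\<Sum>y\<in>sphere i x. f y) = q * f x"
proof (induction i rule: less_induct)
  case (less i)
  show ?case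
  proof (cases i)
    case 0
    have "sphere 0 x = {x}" if "x \<in> V" for x
      using that gdist_0D by (auto simp: sphere_def)
    then show ?thesis
      using 0 by (intro exI[of _ 1]) auto
  next
    case (Suc j)
    show ?thesis
    proof (cases "i \<le> d")
      case False
      then show ?thesis
        using sphere_empty by (intro exI[of _ 0]) auto
    next
      case True
      obtain q where q: "\<And>l f x. l < i \<Longrightarrow> eigenfunction \<theta> f \<Longrightarrow> x \<in> V
          \<Longrightarrow> (\<Sum>y\<in>sphere l x. f y) = q l * f x"
        using less.IH by metis
      \<comment> \<open>The recurrence at \<open>j = i - 1\<close>, solved for the sphere of radius
        \<open>i\<close>.\<close>
      define Q where "Q = (\<theta> * q j - (\<Sum>l<i. int_num j l * q l)) / c i"
      have "(\<Sum>y\<in>sphere i x. f y) = Q * f x" if f: "eigenfunction \<theta> f" and x: "x \<in> V" for f x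
      proof -
        have "\<theta> * (q j * f x) = (\<Sum>l\<le>d. int_num j l * (\<Sum>y\<in>sphere l x. f y))"
          using sphere_sum_recurrence[OF f x, of j] q[of j] f x Suc by simp
        also have "\<dots> = (\<Sum>l\<in>{..<i} \<union> {i}. int_num j l * (\<Sum>y\<in>sphere l x. f y))"
          using True Suc by (intro sum.mono_neutral_right) (auto simp: int_num_def)
        also have "\<dots> = (\<Sum>l<i. int_num j l * (\<Sum>y\<in>sphere l x. f y)) + c i * (\<Sum>y\<in>sphere i x. f y)"
          using Suc by (subst sum.union_disjoint) (auto simp: int_num_def)
        also have "(\<Sum>l<i. int_num j l * (\<Sum>y\<in>sphere l x. f y)) = (\<Sum>l<i. int_num j l * q l) * f x"
          using q f x by (simp add: sum_distrib_right mult.assoc)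
        finally show ?thesis
          using c_pos[of j] True Suc by (simp add: Q_def field_simps)
      qed
      then show ?thesis
        by blast
    qed
  qed
qed

lemma sphere_sum:
  obtains q where "\<And>i f x. eigenfunction \<theta> f \<Longrightarrow> x \<in> V \<Longrightarrow> (\<Sum>y\<in>sphere i x. f y) = q i * f x"
  using sphere_sum_ex by metis

lemma eigenfunction_const: "eigenfunction (b 0) (\<lambda>_. 1)"
  using degree by (simp add: eigenfunction_def)

text \<open>Sphere sums of the constant eigenfunction are cardinalities, hence independent of the
  centre.\<close>

lemma sphere_card:
  obtains k where "\<And>i x. x \<in> V \<Longrightarrow> card (sphere i x) = k i" "\<And>i. i \<le> d \<Longrightarrow> k i > 0"
proof -
  obtain q :: "nat \<Rightarrow> real" where q: "\<And>i x. x \<in> V \<Longrightarrow> real (card (sphere i x)) = q i"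
  proof (rule sphere_sum[of "b 0"])
    fix q assume "\<And>i f x. eigenfunction (real (b 0)) f \<Longrightarrow> x \<in> V \<Longrightarrow> (\<Sum>y\<in>sphere i x. f y) = q i * f x"
    from this[OF eigenfunction_const] show thesis
      by (intro that[of q]) simp
  qed
  define k where "k i = nat \<lfloor>q i\<rfloor>" for i
  have k: "card (sphere i x) = k i" if "x \<in> V" for i x
    using q[OF that, of i, symmetric] by (simp add: k_def)
  have "k i > 0" if "i \<le> d" for i
  proof -
    obtain x y where "x \<in> V" "y \<in> V" "gdist x y = i"
      using distance_attained \<open>i \<le> d\<close> by blast
    then have "y \<in> sphere i x"
      by (simp add: sphere_def)
    then show ?thesis
      using k[OF \<open>x \<in> V\<close>, of i] finite_sphere[of i x] by (metis card_gt_0_iff empty_iff)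
  qed
  with k that show ?thesis
    by blast
qed

text \<open>Both sides count the adjacent pairs with one vertex in each of the two spheres around
  \<open>x\<close>.\<close>

lemma int_num_symmetric:
  assumes "x \<in> V"
  shows "card (sphere l x) * int_num i l = card (sphere i x) * int_num l i"
proof -
  have *: "(\<Sum>z\<in>sphere l x. \<Sum>y\<in>{y\<in>sphere i x. (y, z) \<in> E}. 1) = card (sphere l x) * int_num i l" for i l
  proof -
    have "(\<Sum>y\<in>{y\<in>sphere i x. (y, z) \<in> E}. 1) = int_num i l" if "z \<in> sphere l x" for z
    proof -
      have "{y \<in> sphere i x. (y, z) \<in> E} = {y. (z, y) \<in> E \<and> gdist x y = i}"
        using E_sym E_in_V by (auto simp: sphere_def)
      then show ?thesis
        using card_int_num[OF assms, of z i] that by (simp add: sphere_def)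
    qed
    then show ?thesis
      by simp
  qed
  have "(\<Sum>z\<in>sphere l x. \<Sum>y\<in>{y\<in>sphere i x. (y, z) \<in> E}. 1) = 
     (\<Sum>y\<in>sphere i x. \<Sum>z\<in>{z\<in>sphere l x. (y, z) \<in> E}. 1::nat)"
    by (rule sum.swap_restrict[OF finite_sphere finite_sphere])
  also have "\<dots> = (\<Sum>y\<in>sphere i x. \<Sum>z\<in>{z\<in>sphere l x. (z, y) \<in> E}. 1)"
    using E_sym by (intro sum.cong refl) auto
  finally show ?thesis
    unfolding * .
qed

text \<open>The matrix with entries \<open>u (gdist x y)\<close> has its columns in the eigenspace
  and acts there as the scalar \<open>\<kappa>\<close>, so it is a multiple of the orthogonal
  projection. Divided by \<open>sqrt \<kappa>\<close>, its rows have the matrix itself as Gram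
  matrix.\<close>

theorem eigenvalue_representation:
  assumes f: "eigenfunction \<theta> f" "\<exists>x\<in>V. f x \<noteq> 0" and d: "d \<ge> 1"
  obtains u :: "nat \<Rightarrow> real" and \<phi> :: "'a \<Rightarrow> 'a \<Rightarrow> real"
  where "u 0 = 1" "b 0 * u 1 = \<theta>" "1 + a 1 * u 1 + b 1 * u 2 = \<theta> * u 1"
    "\<And>x y. x \<in> V \<Longrightarrow> y \<in> V \<Longrightarrow> (\<Sum>z\<in>V. \<phi> x z * \<phi> y z) = u (gdist x y)"
proof -
  obtain q where q: "\<And>i f x. eigenfunction \<theta> f \<Longrightarrow> x \<in> V \<Longrightarrow> (\<Sum>y\<in>sphere i x. f y) = q i * f x"
    using sphere_sum by blast
  obtain k where k: "\<And>i x. x \<in> V \<Longrightarrow> card (sphere i x) = k i" and k_pos: "\<And>i. i \<le> d \<Longrightarrow> k i > 0"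
    using sphere_card by blast
  obtain x\<^sub>0 where x0: "x\<^sub>0 \<in> V" "f x\<^sub>0 \<noteq> 0"
    using f by blast
  have s0: "sphere 0 x\<^sub>0 = {x\<^sub>0}"
    using x0 gdist_0D by (auto simp: sphere_def)
  have q0: "q 0 = 1" and k0: "k 0 = 1"
    using q[OF f(1) x0(1), of 0] k[OF x0(1), of 0] s0 x0 by auto
  have rec: "\<theta> * q i = (\<Sum>l\<le>d. int_num i l * q l)" for i
  proof -
    have "\<theta> * q i * f x\<^sub>0 = (\<Sum>l\<le>d. int_num i l * q l) * f x\<^sub>0"
      using sphere_sum_recurrence[OF f(1) x0(1), of i] q[OF f(1) x0(1)]
      by (simp add: sum_distrib_right mult.assoc)
    then show ?thesis
      using x0 by simp
  qed
  \<comment> \<open>The average of an eigenfunction over a sphere relative to its value at the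
    centre (cosine sequence).\<close>
  define u where "u i = q i / k i" for i
  have ku: "k i * u i = q i" if "i \<le> d" for i
    using k_pos[OF that] by (simp add: u_def)
  have eig: "eigenfunction \<theta> (\<lambda>y. u (gdist x y))" if x: "x \<in> V" for x
    unfolding eigenfunction_def
  proof
    fix y assume y: "y \<in> V"
    define l where "l = gdist x y"
    have l: "l \<le> d"
      using gdist_le_d x y by (simp add: l_def)
    have "k l * (\<Sum>z\<in>neighbors X y. u (gdist x z)) = (\<Sum>i\<le>d. (k l * int_num i l) * u i)"
      using sum_neighbors_by_distance[OF x y, of u] by (simp add: l_def sum_distrib_left mult.assoc)
    also have "\<dots> = (\<Sum>i\<le>d. int_num l i * q i)"
    proof (intro sum.cong refl)
      fix i assume "i \<in> {..d}"
      have "k l * int_num i l = k i * int_num l i"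
        using int_num_symmetric[OF x, of l i] k[OF x] by simp
      then have "real (k l) * real (int_num i l) = real (k i) * real (int_num l i)"
        by (metis of_nat_mult)
      then show "(k l * int_num i l) * u i = int_num l i * q i"
        using ku[of i] \<open>i \<in> {..d}\<close> by simp
    qed
    also have "\<dots> = k l * (\<theta> * u l)"
      using rec[of l] ku[OF l] by (simp add: ac_simps)
    finally show "(\<Sum>z\<in>neighbors X y. u (gdist x z)) = \<theta> * u (gdist x y)"
      using k_pos[OF l] by (simp add: l_def)
  qed
  \<comment> \<open>This is the sum of \<open>k i * u i * u i\<close>; the term for
    \<open>i = 0\<close> is 1.\<close>
  define \<kappa> where "\<kappa> = (\<Sum>i\<le>d. u i * q i)"
  have "\<kappa> > 0"
    unfolding \<kappa>_def by (rule sum_pos2[of _ 0]) (auto simp: u_def q0 k0)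
  have U: "(\<Sum>y\<in>V. u (gdist x y) * g y) = \<kappa> * g x" if "x \<in> V" "eigenfunction \<theta> g" for x g
    unfolding sum_by_distance[OF that(1)] \<kappa>_def using q[OF that(2,1)]
    by (simp add: sum_distrib_right mult.assoc)
  define \<phi> where "\<phi> x z = u (gdist x z) / sqrt \<kappa>" for x z
  have gram: "(\<Sum>z\<in>V. \<phi> x z * \<phi> y z) = u (gdist x y)" if "x \<in> V" "y \<in> V" for x y
  proof -
    have "(\<Sum>z\<in>V. \<phi> x z * \<phi> y z) = (\<Sum>z\<in>V. u (gdist x z) * u (gdist y z)) / \<kappa>"
      using \<open>\<kappa> > 0\<close> by (simp add: \<phi>_def sum_divide_distrib)
    also have "\<dots> = u (gdist x y)"
      using U[OF that(1) eig[OF that(2)]] \<open>\<kappa> > 0\<close> gdist_commute that by simp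
    finally show ?thesis .
  qed
  have u0: "u 0 = 1"
    by (simp add: u_def q0 k0)
  obtain x y where xy: "x \<in> V" "y \<in> V" "gdist x y = 1"
    using distance_attained d by blast
  have "(\<Sum>z\<in>neighbors X x. u (gdist x z)) = (\<Sum>z\<in>neighbors X x. u 1)"
  proof (intro sum.cong refl)
    fix z assume "z \<in> neighbors X x"
    then have "gdist x z = 1"
      using gdist_1_iff E_in_V by blast
    then show "u (gdist x z) = u 1"
      by simp
  qed
  then have "b 0 * u 1 = \<theta>"
    using eig[OF xy(1)] xy(1) degree[OF xy(1)] u0 by (simp add: eigenfunction_def)
  moreover have "1 + a 1 * u 1 + b 1 * u 2 = \<theta> * u 1"
  proof -
    have "(y, x) \<in> E"
      using xy E_sym gdist_1_iff by blast
    then have "{z. (y, z) \<in> E \<and> gdist x z = 0} = {x}"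
      using gdist_0D[OF xy(1)] E_in_V(2)[of y] xy(1) by auto
    then have c1: "c 1 = 1"
      using card_c[of x y 0] xy by simp
    have "(\<Sum>z\<in>neighbors X y. u (gdist x z)) = (\<Sum>i\<le>d. int_num i 1 * u i)"
      using sum_neighbors_by_distance[OF xy(1,2), of u] xy by simp
    \<comment> \<open>For \<open>d = 1\<close> the index 2 is out of range, but its coefficient
      \<open>b 1\<close> is then zero.\<close>
    also have "\<dots> = (\<Sum>i\<in>{0,1,2}. int_num i 1 * u i)"
    proof (cases "d \<ge> 2")
      case True
      then show ?thesis
        by (intro sum.mono_neutral_right) (auto simp: int_num_def)
    next
      case False
      then have "d = 1"
        using d by simp
      have "{z. (y, z) \<in> E \<and> gdist x z = Suc 1} = {}"
        using gdist_le_d[OF xy(1)] E_in_V \<open>d = 1\<close> by fastforce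
      then have "b 1 = 0"
        using card_b[OF xy] by (metis card.empty)
      then show ?thesis
        using \<open>d = 1\<close> by (simp add: int_num_def)
    qed
    also have "\<dots> = 1 + a 1 * u 1 + b 1 * u 2"
      using c1 u0 by (simp add: int_num_def numeral_2_eq_2)
    finally show ?thesis
      using eig[OF xy(1)] xy by (simp add: eigenfunction_def)
  qed
  ultimately show ?thesis
    using that u0 gram by blast
qed

section \<open>The adjacency spectrum\<close>

lemma eigenfunction_bound:
  assumes "eigenfunction \<theta> f" "\<exists>x\<in>V. f x \<noteq> 0"
  shows "\<bar>\<theta>\<bar> \<le> b 0"
proof -
  \<comment> \<open>The eigenvalue equation at a vertex where the absolute value is maximal gives
    the bound.\<close>
  define M where "M = Max ((\<lambda>x. \<bar>f x\<bar>) ` V)"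
  have M: "\<bar>f x\<bar> \<le> M" if "x \<in> V" for x
    using that V_finite by (simp add: M_def)
  have "M \<in> (\<lambda>x. \<bar>f x\<bar>) ` V"
    unfolding M_def using V_finite V_nonempty by (intro Max_in) auto
  then obtain x where x: "x \<in> V" "M = \<bar>f x\<bar>"
    by blast
  have "M > 0"
    using assms(2) M by (metis abs_ge_zero abs_le_zero_iff dual_order.strict_trans1 linorder_not_less)
  have "\<bar>\<theta>\<bar> * M = \<bar>\<Sum>y\<in>neighbors X x. f y\<bar>"
    using assms(1) x by (simp add: eigenfunction_def abs_mult)
  also have "\<dots> \<le> (\<Sum>y\<in>neighbors X x. M)"
    using M E_in_V by (intro order.trans[OF sum_abs] sum_mono) auto
  also have "\<dots> = b 0 * M"
    using degree[OF x(1)] by simp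
  finally show ?thesis
    using \<open>M > 0\<close> by simp
qed

text \<open>The enumeration identifies vectors with functions on \<open>V\<close>. The right-hand
  side is free of the list, so the spectrum can be handled through eigenfunctions alone.\<close>

lemma eigenvalue_adjacency_mat_iff:
  assumes vs: "distinct vs" "set vs = V"
  shows "eigenvalue (adjacency_mat X vs) \<theta> \<longleftrightarrow> (\<exists>f. eigenfunction \<theta> f \<and> (\<exists>x\<in>V. f x \<noteq> 0))"
proof -
  define n where "n = length vs"
  let ?A = "adjacency_mat X vs"
  have A: "?A \<in> carrier_mat n n"
    by (simp add: adjacency_mat_def n_def)
  have bij: "bij_betw ((!) vs) {..<n} V"
    using vs by (auto intro: bij_betw_nth simp: n_def)
  have mult: "(?A *\<^sub>v vec n (\<lambda>i. f (vs ! i))) $ i = (\<Sum>y\<in>neighbors X (vs ! i). f y)"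
    if "i < n" for f i
  proof -
    have "(?A *\<^sub>v vec n (\<lambda>i. f (vs ! i))) $ i =
        (\<Sum>j<n. (if (vs ! i, vs ! j) \<in> E then f (vs ! j) else 0))"
      using that by (auto simp: adjacency_mat_def scalar_prod_def n_def lessThan_atLeast0 intro!: sum.cong)
    also have "\<dots> = (\<Sum>y\<in>V. if (vs ! i, y) \<in> E then f y else 0)"
      by (rule sum.reindex_bij_betw[OF bij])
    also have "\<dots> = (\<Sum>y\<in>{y\<in>V. (vs ! i, y) \<in> E}. f y)"
      using V_finite by (simp add: sum.inter_filter)
    also have "{y\<in>V. (vs ! i, y) \<in> E} = neighbors X (vs ! i)"
      using E_in_V by auto
    finally show ?thesis .
  qed
  have eig: "?A *\<^sub>v vec n (\<lambda>i. f (vs ! i)) = \<theta> \<cdot>\<^sub>v vec n (\<lambda>i. f (vs ! i)) \<longleftrightarrow> eigenfunction \<theta> f" for f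
  proof -
    have "?A *\<^sub>v vec n (\<lambda>i. f (vs ! i)) = \<theta> \<cdot>\<^sub>v vec n (\<lambda>i. f (vs ! i)) \<longleftrightarrow>
        (\<forall>i<n. (\<Sum>y\<in>neighbors X (vs ! i). f y) = \<theta> * f (vs ! i))"
      using A mult by (auto simp: vec_eq_iff)
    also have "\<dots> \<longleftrightarrow> eigenfunction \<theta> f"
      unfolding bij_betw_imp_surj_on[OF bij, symmetric] eigenfunction_def by auto
    finally show ?thesis .
  qed
  have nz: "vec n (\<lambda>i. f (vs ! i)) \<noteq> 0\<^sub>v n \<longleftrightarrow> (\<exists>x\<in>V. f x \<noteq> 0)" for f :: "'a \<Rightarrow> real"
    unfolding bij_betw_imp_surj_on[OF bij, symmetric] by (auto simp: vec_eq_iff)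
  show ?thesis
  proof
    assume "eigenvalue ?A \<theta>"
    then obtain w where w: "w \<in> carrier_vec n" "w \<noteq> 0\<^sub>v n" "?A *\<^sub>v w = \<theta> \<cdot>\<^sub>v w"
      using A by (auto simp: eigenvalue_def eigenvector_def)
    define f where "f x = w $ (the_inv_into {..<n} ((!) vs) x)" for x
    have "f (vs ! i) = w $ i" if "i < n" for i
      using that bij by (simp add: f_def bij_betw_def the_inv_into_f_f)
    then have "w = vec n (\<lambda>i. f (vs ! i))"
      using w(1) by (auto simp: vec_eq_iff)
    with w eig nz show "\<exists>f. eigenfunction \<theta> f \<and> (\<exists>x\<in>V. f x \<noteq> 0)"
      by metis
  next
    assume "\<exists>f. eigenfunction \<theta> f \<and> (\<exists>x\<in>V. f x \<noteq> 0)"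
    then obtain f where "eigenfunction \<theta> f" "\<exists>x\<in>V. f x \<noteq> 0"
      by blast
    then show "eigenvalue ?A \<theta>"
      using A eig[of f] nz[of f] unfolding eigenvalue_def eigenvector_def
      by (intro exI[of _ "vec n (\<lambda>i. f (vs ! i))"]) auto
  qed
qed

lemma adjacency_spectrum_iff:
  "\<theta> \<in> adjacency_spectrum X \<longleftrightarrow> (\<exists>f. eigenfunction \<theta> f \<and> (\<exists>x\<in>V. f x \<noteq> 0))"
proof -
  obtain vs where "distinct vs" "set vs = V"
    using finite_distinct_list[OF V_finite] by blast
  then show ?thesis
    unfolding adjacency_spectrum_def mem_Collect_eq using eigenvalue_adjacency_mat_iff by metis
qed

text \<open>The spectrum is the root set of a monic polynomial. Finiteness makes \<open>Min\<close>
  and \<open>Max\<close> of the spectrum attained.\<close>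

lemma adjacency_spectrum_finite: "finite (adjacency_spectrum X)"
proof -
  obtain vs where vs: "distinct vs" "set vs = V"
    using finite_distinct_list[OF V_finite] by blast
  have A: "adjacency_mat X vs \<in> carrier_mat (length vs) (length vs)"
    by (simp add: adjacency_mat_def)
  have "adjacency_spectrum X = {\<theta>. poly (char_poly (adjacency_mat X vs)) \<theta> = 0}"
    using eigenvalue_adjacency_mat_iff[OF vs] eigenvalue_root_char_poly[OF A] adjacency_spectrum_iff
    by blast
  moreover have "char_poly (adjacency_mat X vs) \<noteq> 0"
    using degree_monic_char_poly[OF A] by auto
  ultimately show ?thesis
    by (simp add: poly_roots_finite)
qed

lemma degree_in_adjacency_spectrum: "real (b 0) \<in> adjacency_spectrum X"
  unfolding adjacency_spectrum_iff using eigenfunction_const V_nonempty by (intro exI[of _ "\<lambda>_. 1"]) auto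

lemma Max_adjacency_spectrum: "Max (adjacency_spectrum X) = b 0"
proof (rule Max_eqI[OF adjacency_spectrum_finite _ degree_in_adjacency_spectrum])
  fix \<theta> assume "\<theta> \<in> adjacency_spectrum X"
  then show "\<theta> \<le> b 0"
    unfolding adjacency_spectrum_iff using eigenfunction_bound by fastforce
qed

end

section \<open>Lines of a geometric distance-regular graph\<close>

locale geometric_drg = distance_regular_graph X d a b c
  for X :: "'a pair_pre_digraph" and d a b c +
  fixes lines :: "'a set set" and m :: real
  assumes d_ge_2: "d \<ge> 2"
    and lines_Delsarte: "C \<in> lines \<Longrightarrow> Delsarte_clique X (b 0) C"
    and line_unique: "(x, y) \<in> E \<Longrightarrow> \<exists>!C. C \<in> lines \<and> x \<in> C \<and> y \<in> C"
    and smallest: "smallest_eigenvalue X = - m"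
begin

lemma d_ge_1: "d \<ge> 1"
  using d_ge_2 by simp

lemma line_sub: "C \<in> lines \<Longrightarrow> C \<subseteq> V"
  using lines_Delsarte by (auto simp: Delsarte_clique_def clique_def)

lemma line_edge: "C \<in> lines \<Longrightarrow> x \<in> C \<Longrightarrow> y \<in> C \<Longrightarrow> x \<noteq> y \<Longrightarrow> (x, y) \<in> E"
  using lines_Delsarte by (auto simp: Delsarte_clique_def clique_def)

lemma line_finite: "C \<in> lines \<Longrightarrow> finite C"
  using line_sub V_finite finite_subset by blast

lemma line_card: "C \<in> lines \<Longrightarrow> real (card C) = 1 + b 0 / m"
  using lines_Delsarte smallest by (auto simp: Delsarte_clique_def)

lemma line_eqI:
  "\<lbrakk>C \<in> lines; D \<in> lines; x \<in> C; x \<in> D; y \<in> C; y \<in> D; x \<noteq> y\<rbrakk> \<Longrightarrow> C = D"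
  using line_unique[OF line_edge[of C x y]] by blast

lemma edge_exists: obtains x y where "(x, y) \<in> E"
  using distance_attained[of 1] d_ge_2 gdist_1_iff that by (metis One_nat_def Suc_1 Suc_leD)

lemma line_card_ge_2: "(x, y) \<in> E \<Longrightarrow> C \<in> lines \<Longrightarrow> x \<in> C \<Longrightarrow> y \<in> C \<Longrightarrow> card C \<ge> 2"
  using card_mono[of C "{x, y}"] line_finite E_irrefl by (cases "x = y") auto

text \<open>A line containing an edge has at least two vertices, so \<open>b 0 / m\<close> is at
  least 1; this excludes negative \<open>m\<close> and also \<open>m = 0\<close>, where the quotient
  is 0.\<close>

lemma m_pos: "m > 0"
proof -
  obtain x y where xy: "(x, y) \<in> E"
    by (rule edge_exists)
  then obtain C where C: "C \<in> lines" "x \<in> C" "y \<in> C"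
    using line_unique by blast
  have "1 \<le> real (b 0) / m"
    using line_card_ge_2[OF xy C] line_card[OF C(1)] by simp
  then show ?thesis
    using divide_nonneg_nonpos[of "real (b 0)" m] by (cases "m > 0") auto
qed

text \<open>A line has \<open>n + 1\<close> vertices; since the size of a line is an integer,
  rounding down loses nothing.\<close>

definition n :: nat where "n = nat \<lfloor>b 0 / m\<rfloor>"

lemma n_eq: "real n = b 0 / m" and n_pos: "n \<ge> 1"
  and card_line: "C \<in> lines \<Longrightarrow> card C = Suc n"
proof -
  obtain x y where xy: "(x, y) \<in> E"
    by (rule edge_exists)
  then obtain D where D: "D \<in> lines" "x \<in> D" "y \<in> D"
    using line_unique by blast
  have "b 0 / m = real (card D - 1)" and ge: "card D - 1 \<ge> 1"
    using line_card_ge_2[OF xy D] line_card[OF D(1)] by auto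
  then have "n = card D - 1"
    by (simp add: n_def)
  with ge \<open>b 0 / m = real (card D - 1)\<close> show n: "real n = b 0 / m" "n \<ge> 1"
    by auto
  show "card C = Suc n" if "C \<in> lines"
    using line_card[OF that] n(1) by linarith
qed

section \<open>The lines through a vertex\<close>

definition lines_at :: "'a \<Rightarrow> 'a set set" where
  "lines_at x = {C \<in> lines. x \<in> C}"

lemma finite_lines_at: "finite (lines_at x)"
  using line_sub by (intro finite_subset[OF _ finite_Pow_iff[THEN iffD2, OF V_finite]]) (auto simp: lines_at_def)

lemma neighbors_lines: "neighbors X x = (\<Union>C\<in>lines_at x. C - {x})"
proof
  show "neighbors X x \<subseteq> (\<Union>C\<in>lines_at x. C - {x})"
    using line_unique E_irrefl by (fastforce simp: lines_at_def)
qed (auto simp: lines_at_def line_edge)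

lemma degree_lines_at: "x \<in> V \<Longrightarrow> b 0 = card (lines_at x) * n"
proof -
  assume x: "x \<in> V"
  have "card (neighbors X x) = (\<Sum>C\<in>lines_at x. card (C - {x}))"
    unfolding neighbors_lines using finite_lines_at line_finite line_eqI
    by (intro card_UN_disjoint) (fastforce simp: lines_at_def)+
  also have "\<dots> = (\<Sum>C\<in>lines_at x. n)"
    using card_line line_finite by (intro sum.cong) (auto simp: lines_at_def)
  finally show ?thesis
    using degree[OF x] by simp
qed

text \<open>The lines through \<open>x\<close> split its \<open>m * n\<close> neighbours into blocks
  of size \<open>n\<close>. In particular the real number \<open>m\<close> is an integer.\<close>

lemma card_lines_at: "x \<in> V \<Longrightarrow> real (card (lines_at x)) = m"
proof -
  assume "x \<in> V"
  then have "real (b 0) = real (card (lines_at x)) * real n"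
    using degree_lines_at by simp
  moreover have "real (b 0) = m * real n"
    using n_eq m_pos by simp
  ultimately show ?thesis
    using n_pos by simp
qed

lemma smallest_in_spectrum: "- m \<in> adjacency_spectrum X"
  unfolding smallest[symmetric] smallest_eigenvalue_def
  using adjacency_spectrum_finite degree_in_adjacency_spectrum by (intro Min_in) auto

text \<open>In the representation belonging to the smallest eigenvalue the vertices of a Delsarte clique
  sum to the zero vector, because the squared norm of their sum is proportional to
  \<open>1 + (k / m) * (- m / k) = 0\<close>.\<close>

lemma line_sum_zero:
  obtains u :: "nat \<Rightarrow> real" where "u 1 \<noteq> 0"
    "\<And>C x. C \<in> lines \<Longrightarrow> x \<in> V \<Longrightarrow> (\<Sum>y\<in>C. u (gdist x y)) = 0"
proof -
  obtain f where f: "eigenfunction (- m) f" "\<exists>x\<in>V. f x \<noteq> 0"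
    using smallest_in_spectrum by (auto simp: adjacency_spectrum_iff)
  obtain u :: "nat \<Rightarrow> real" and \<phi> :: "'a \<Rightarrow> 'a \<Rightarrow> real"
    where u: "u 0 = 1" "b 0 * u 1 = - m"
    and gram: "\<And>x y. x \<in> V \<Longrightarrow> y \<in> V \<Longrightarrow> (\<Sum>z\<in>V. \<phi> x z * \<phi> y z) = u (gdist x y)"
    by (rule eigenvalue_representation[OF f d_ge_1]) (rule that)
  have "(\<Sum>y\<in>C. u (gdist x y)) = 0" if C: "C \<in> lines" and x: "x \<in> V" for C x
  proof -
    have inner: "(\<Sum>z\<in>V. \<phi> p z * (\<Sum>y\<in>C. \<phi> y z)) = (\<Sum>y\<in>C. u (gdist p y))" if "p \<in> V" for p
    proof -
      have "(\<Sum>z\<in>V. \<phi> p z * (\<Sum>y\<in>C. \<phi> y z)) = (\<Sum>y\<in>C. \<Sum>z\<in>V. \<phi> p z * \<phi> y z)"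
        by (subst sum.swap) (simp add: sum_distrib_left)
      also have "\<dots> = (\<Sum>y\<in>C. u (gdist p y))"
        using gram that line_sub[OF C] by (intro sum.cong refl) auto
      finally show ?thesis .
    qed
    have row: "(\<Sum>y\<in>C. u (gdist p y)) = 0" if p: "p \<in> C" for p
    proof -
      have "(\<Sum>y\<in>C. u (gdist p y)) = u (gdist p p) + (\<Sum>y\<in>C - {p}. u (gdist p y))"
        using line_finite[OF C] p by (rule sum.remove)
      also have "(\<Sum>y\<in>C - {p}. u (gdist p y)) = (\<Sum>y\<in>C - {p}. u 1)"
      proof (intro sum.cong refl)
        fix y assume "y \<in> C - {p}"
        then have "gdist p y = 1"
          using line_edge[OF C p] gdist_1_iff E_in_V by blast
        then show "u (gdist p y) = u 1"
          by simp
      qed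
      also have "\<dots> = real n * u 1"
        using card_line[OF C] p line_finite[OF C] by simp
      also have "real n * u 1 = (b 0 * u 1) / m"
        using n_eq by simp
      also have "\<dots> = - 1"
        unfolding u(2) using m_pos by simp
      finally show ?thesis
        using u(1) p line_sub[OF C] by auto
    qed
    have "(\<Sum>z\<in>V. (\<Sum>y\<in>C. \<phi> y z)\<^sup>2) = (\<Sum>z\<in>V. \<Sum>p\<in>C. \<phi> p z * (\<Sum>y\<in>C. \<phi> y z))"
      by (simp add: power2_eq_square sum_distrib_right)
    also have "\<dots> = (\<Sum>p\<in>C. \<Sum>z\<in>V. \<phi> p z * (\<Sum>y\<in>C. \<phi> y z))"
      by (rule sum.swap)
    also have "\<dots> = 0"
      using inner row line_sub[OF C] by (intro sum.neutral) auto
    finally have "\<forall>z\<in>V. (\<Sum>y\<in>C. \<phi> y z) = 0"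
      using V_finite by (subst (asm) sum_nonneg_eq_0_iff) auto
    then show ?thesis
      using inner[OF x] by simp
  qed
  moreover have "u 1 \<noteq> 0"
    using u(2) m_pos by auto
  ultimately show ?thesis
    using that by blast
qed

text \<open>A vertex off a line with a neighbour on it is at distance 1 or 2 from every vertex of
  the line. The vanishing line sum becomes \<open>\<psi> * (u 1 - u 2) + (n + 1) * u 2 = 0\<close>,
  which determines \<open>\<psi>\<close>.\<close>

lemma line_neighbors_constant:
  obtains \<psi> :: nat where
    "\<And>C x y. \<lbrakk>C \<in> lines; x \<notin> C; y \<in> C; (x, y) \<in> E\<rbrakk> \<Longrightarrow> card {z \<in> C. (x, z) \<in> E} = \<psi>"
proof -
  obtain u :: "nat \<Rightarrow> real" where u1: "u 1 \<noteq> 0"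
    and u: "\<And>C x. C \<in> lines \<Longrightarrow> x \<in> V \<Longrightarrow> (\<Sum>y\<in>C. u (gdist x y)) = 0"
    by (rule line_sum_zero) blast
  have eq: "real (card {z \<in> C. (x, z) \<in> E}) * (u 1 - u 2) + real (Suc n) * u 2 = 0"
    if C: "C \<in> lines" and x: "x \<notin> C" and y: "y \<in> C" "(x, y) \<in> E" for C x y
  proof -
    have xV: "x \<in> V"
      using y E_in_V by blast
    have d2: "gdist x z = 2" if "z \<in> C" "(x, z) \<notin> E" for z
    proof -
      have "(y, z) \<in> E"
        using line_edge[OF C y(1) that(1)] that y by auto
      then show ?thesis
        using gdist_2_iff[of x z] xV E_in_V that x y by blast
    qed
    have "u (gdist x z) = (if (x, z) \<in> E then u 1 - u 2 else 0) + u 2" if "z \<in> C" for z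
      using d2[OF that] gdist_1_iff[of x z] xV E_in_V by auto
    then have "(\<Sum>z\<in>C. u (gdist x z)) = (\<Sum>z\<in>C. (if (x, z) \<in> E then u 1 - u 2 else 0) + u 2)"
      by (intro sum.cong) auto
    also have "\<dots> = real (card {z \<in> C. (x, z) \<in> E}) * (u 1 - u 2) + real (card C) * u 2"
      using line_finite[OF C] by (simp add: sum.distrib flip: sum.inter_filter)
    finally show ?thesis
      using u[OF C xV] card_line[OF C] by simp
  qed
  \<comment> \<open>Equality would reduce the relation to \<open>(n + 1) * u 1 = 0\<close>.\<close>
  have ne: "u 1 \<noteq> u 2"
    if "C \<in> lines" "x \<notin> C" "y \<in> C" "(x, y) \<in> E" for C x y
    using eq[OF that] u1 by auto
  have unique: "card {z \<in> C. (x, z) \<in> E} = card {z \<in> D. (x', z) \<in> E}"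
    if "C \<in> lines" "x \<notin> C" "y \<in> C" "(x, y) \<in> E"
      "D \<in> lines" "x' \<notin> D" "y' \<in> D" "(x', y') \<in> E" for C x y D x' y'
  proof -
    have "(real (card {z \<in> C. (x, z) \<in> E}) - real (card {z \<in> D. (x', z) \<in> E})) * (u 1 - u 2) = 0"
      using eq[OF that(1-4)] eq[OF that(5-8)] unfolding left_diff_distrib by linarith
    then show ?thesis
      using ne[OF that(1-4)] unfolding mult_eq_0_iff by linarith
  qed
  show ?thesis
  proof (cases "\<exists>C x y. C \<in> lines \<and> x \<notin> C \<and> y \<in> C \<and> (x, y) \<in> E")
    case True
    then obtain D x' y' where D: "D \<in> lines" "x' \<notin> D" "y' \<in> D" "(x', y') \<in> E"
      by blast
    show ?thesis
      by (rule that[of "card {z \<in> D. (x', z) \<in> E}"]) (rule unique[OF _ _ _ _ D])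
  next
    \<comment> \<open>No such configuration exists, so the claim is vacuous and 0 is an arbitrary
      value.\<close>
    case False
    then show ?thesis
      by (intro that[of 0]) blast
  qed
qed

text \<open>Two neighbours on one line would give \<open>\<psi> \<ge> 2\<close> for all lines; then
  any two vertices of the neighbourhood graph of \<open>v\<close> would be joined by a path of
  length at most two inside it.\<close>

lemma line_single_neighbor:
  assumes v: "v \<in> V" and disc: "\<not> Digraph_Component.connected (neighborhood_graph X v)"
    and xC: "C \<in> lines" "x \<notin> C" "y \<in> C" "z \<in> C" "(x, y) \<in> E" "(x, z) \<in> E"
  shows "y = z"
proof (rule ccontr)
  assume "y \<noteq> z"
  obtain \<psi> where \<psi>: "\<And>C x y. \<lbrakk>C \<in> lines; x \<notin> C; y \<in> C; (x, y) \<in> E\<rbrakk>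
      \<Longrightarrow> card {z \<in> C. (x, z) \<in> E} = \<psi>"
    by (rule line_neighbors_constant) blast
  have "card {y, z} \<le> card {z \<in> C. (x, z) \<in> E}"
    using xC line_finite by (intro card_mono) auto
  then have "\<psi> \<ge> 2"
    using \<psi>[OF xC(1,2,3,5)] \<open>y \<noteq> z\<close> by simp
  define N where "N = neighbors X v"
  let ?G = "neighborhood_graph X v"
  have verts: "pverts (mk_symmetric ?G) = N"
    by (simp add: mk_symmetric_def neighborhood_graph_def induce_subgraph_def N_def)
  have arcs: "parcs (mk_symmetric ?G) = {(p, q). p \<in> N \<and> q \<in> N \<and> (p, q) \<in> E}"
    using E_sym by (auto simp: mk_symmetric_def neighborhood_graph_def induce_subgraph_def N_def)
  have step: "(p, q) \<in> rtrancl_on N {(p, q). p \<in> N \<and> q \<in> N \<and> (p, q) \<in> E}"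
    if "p \<in> N" "q \<in> N" "(p, q) \<in> E" for p q
    using that by (intro rtrancl_on_into_rtrancl_on[OF rtrancl_on_refl]) auto
  have "(p, q) \<in> rtrancl_on N {(p, q). p \<in> N \<and> q \<in> N \<and> (p, q) \<in> E}"
    if p: "p \<in> N" and q: "q \<in> N" for p q
  proof -
    consider "p = q" | "(p, q) \<in> E" | "p \<noteq> q" "(p, q) \<notin> E"
      by blast
    then show ?thesis
    proof cases
      case 1
      then show ?thesis
        using p by simp
    next
      case 2
      then show ?thesis
        using step p q by blast
    next
      case 3
      have vq: "(v, q) \<in> E" "(p, v) \<in> E"
        using p q E_sym by (auto simp: N_def)
      then obtain D where D: "D \<in> lines" "v \<in> D" "q \<in> D"
        using line_unique by blast
      then have "p \<notin> D"
        using line_edge[of D p q] 3 by blast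
      \<comment> \<open>On the line through \<open>v\<close> and \<open>q\<close>, the vertex
        \<open>p\<close> has the neighbour \<open>v\<close>; a second one is a common neighbour of
        \<open>p\<close> and \<open>q\<close> in the neighbourhood graph.\<close>
      from \<psi>[OF D(1) this D(2) vq(2)] have "card {w \<in> D. (p, w) \<in> E} \<ge> 2"
        using \<open>\<psi> \<ge> 2\<close> by simp
      then have "\<not> {w \<in> D. (p, w) \<in> E} \<subseteq> {v}"
        using card_mono[of "{v}" "{w \<in> D. (p, w) \<in> E}"] by auto
      then obtain w where w: "w \<in> D" "(p, w) \<in> E" "w \<noteq> v"
        by blast
      then have "w \<in> N" "(w, q) \<in> E"
        using line_edge[OF D(1)] D 3 by (auto simp: N_def)
      then show ?thesis
        using step[OF p _ w(2)] step[OF _ q] rtrancl_on_trans by fastforce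
    qed
  qed
  moreover have "N \<noteq> {}"
  proof
    assume "N = {}"
    then have "b 0 = 0"
      using degree[OF v] by (simp add: N_def)
    then show False
      using n_eq n_pos by simp
  qed
  ultimately have "Digraph_Component.connected ?G"
    unfolding Digraph_Component.connected_def strongly_connected_def reachable_def
      with_proj_simps verts arcs by blast
  with disc show False
    by blast
qed

end

section \<open>Graphs whose quadrangles are almost parallelograms\<close>

definition words :: "nat \<Rightarrow> nat \<Rightarrow> nat list set" where
  "words s j = {ts. length ts = j \<and> set ts \<subseteq> {..<s}}"

lemma words_nth: "ts \<in> words s j \<Longrightarrow> i < j \<Longrightarrow> ts ! i < s"
  by (auto simp: words_def subset_iff)

lemma words_update: "ts \<in> words s j \<Longrightarrow> y < s \<Longrightarrow> ts[i := y] \<in> words s j"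
  by (auto simp: words_def dest!: set_update_subset_insert[THEN subsetD])

lemma words_Suc: "ts \<in> words s (Suc j) \<longleftrightarrow> (\<exists>us\<in>words s j. \<exists>u<s. ts = us @ [u])"
  by (cases ts rule: rev_cases) (auto simp: words_def)

text \<open>The decomposition is a pointwise premise, so that error bounds for composed
  displacements chain by single rule applications.\<close>

lemma L2_set_add_le:
  assumes "\<And>i. i \<in> A \<Longrightarrow> f i = g i + h i" "L2_set g A \<le> r" "L2_set h A \<le> q"
  shows "L2_set f A \<le> r + q"
proof -
  have "L2_set f A = L2_set (\<lambda>i. g i + h i) A"
    by (intro L2_set_cong) (auto simp: assms(1))
  then show ?thesis
    using L2_set_triangle_ineq[of g h A] assms(2,3) by linarith
qed

lemma L2_set_diff_le:
  assumes "\<And>i. i \<in> A \<Longrightarrow> f i = g i - h i" "L2_set g A \<le> r" "L2_set h A \<le> q"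
  shows "L2_set f A \<le> r + q"
proof (rule L2_set_add_le[where h = "\<lambda>i. - h i"])
  show "L2_set (\<lambda>i. - h i) A \<le> q"
    using assms(3) by (simp add: L2_set_def)
qed (use assms in auto)

lemma L2_set_diff_commute: "L2_set (\<lambda>i. f i - g i) A = L2_set (\<lambda>i. g i - f i) A"
  by (simp add: L2_set_def power2_commute)

lemma L2_set_power2: "finite A \<Longrightarrow> (L2_set f A)\<^sup>2 = (\<Sum>i\<in>A. (f i)\<^sup>2)"
  by (simp add: L2_set_def sum_nonneg)

text \<open>For the quadrangle \<open>f, g, k, h\<close> the right-hand side is the four squared
  sides minus the two squared diagonals; it measures the failure to be a parallelogram.\<close>

lemma L2_set_parallelogram:
  assumes "finite A"
  shows "(L2_set (\<lambda>i. (f i - g i) - (h i - k i)) A)\<^sup>2 =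
    (L2_set (\<lambda>i. f i - g i) A)\<^sup>2 + (L2_set (\<lambda>i. h i - k i) A)\<^sup>2
    + (L2_set (\<lambda>i. f i - h i) A)\<^sup>2 + (L2_set (\<lambda>i. g i - k i) A)\<^sup>2
    - (L2_set (\<lambda>i. f i - k i) A)\<^sup>2 - (L2_set (\<lambda>i. g i - h i) A)\<^sup>2"
  unfolding L2_set_power2[OF assms] sum.distrib[symmetric] sum_subtractf[symmetric]
  by (intro sum.cong refl) (simp add: power2_eq_square algebra_simps)

lemma sum_mult_le_L2_set: "\<bar>\<Sum>i\<in>A. f i * g i\<bar> \<le> L2_set f A * L2_set g A"
proof -
  have "\<bar>\<Sum>i\<in>A. f i * g i\<bar> \<le> (\<Sum>i\<in>A. \<bar>f i\<bar> * \<bar>g i\<bar>)"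
    by (intro order.trans[OF sum_abs]) (simp add: abs_mult)
  also have "\<dots> \<le> L2_set f A * L2_set g A"
    by (rule L2_set_mult_ineq)
  finally show ?thesis .
qed

text \<open>The metric data that suffice for Hamming coordinates. \<open>L i p\<close> is vertex
  number \<open>p\<close> of line number \<open>i\<close> through \<open>x\<^sub>0\<close>, with 0
  labelling \<open>x\<^sub>0\<close> itself; \<open>fourth\<close> completes two edges to an induced
  quadrangle.\<close>

locale parallelogram_graph =
  fixes V :: "'a set" and E :: "'a rel" and B :: "'b set" and \<phi> :: "'a \<Rightarrow> 'b \<Rightarrow> real" and \<eta> :: real
    and m s :: nat and x\<^sub>0 :: 'a and L :: "nat \<Rightarrow> nat \<Rightarrow> 'a"
  assumes finite_B: "finite B"
    and finite_V: "finite V"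
    and E_sub: "E \<subseteq> V \<times> V"
    and E_sym: "(x, y) \<in> E \<Longrightarrow> (y, x) \<in> E"
    and E_irrefl: "(x, x) \<notin> E"
    and E_norm: "(x, y) \<in> E \<Longrightarrow> (L2_set (\<lambda>b. \<phi> x b - \<phi> y b) B)\<^sup>2 = 2"
    and nonedge_norm: "\<lbrakk>(x, y) \<in> E; (x, z) \<in> E; y \<noteq> z; (y, z) \<notin> E\<rbrakk>
      \<Longrightarrow> (L2_set (\<lambda>b. \<phi> y b - \<phi> z b) B)\<^sup>2 = 4 - 2 * \<eta>"
    and fourth: "\<lbrakk>(x, y) \<in> E; (x, z) \<in> E; y \<noteq> z; (y, z) \<notin> E\<rbrakk>
      \<Longrightarrow> \<exists>w. (y, w) \<in> E \<and> (z, w) \<in> E \<and> w \<noteq> x \<and> (x, w) \<notin> E"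
    and m_ge: "m \<ge> 2"
    and s_pos: "s > 0"
    and \<eta>_nonneg: "\<eta> \<ge> 0"
    and \<eta>_small: "12 * real m ^ 4 * \<eta> \<le> 1"
    and base: "x\<^sub>0 \<in> V"
    and L_0: "i < m \<Longrightarrow> L i 0 = x\<^sub>0"
    and L_same: "\<lbrakk>i < m; p < s; q < s; p \<noteq> q\<rbrakk> \<Longrightarrow> (L i p, L i q) \<in> E"
    and L_other: "\<lbrakk>i < m; j < m; i \<noteq> j; 0 < p; p < s; 0 < q; q < s\<rbrakk>
      \<Longrightarrow> L i p \<noteq> L j q \<and> (L i p, L j q) \<notin> E"
    and E_degree: "x \<in> V \<Longrightarrow> card {y. (x, y) \<in> E} = m * (s - 1)"
    and E_connected: "\<lbrakk>S \<subseteq> V; x\<^sub>0 \<in> S; \<And>x y. x \<in> S \<Longrightarrow> (x, y) \<in> E \<Longrightarrow> y \<in> S\<rbrakk> \<Longrightarrow> S = V"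
begin

section \<open>Displacements, thresholds and quadrangles\<close>

definition disp :: "'a \<Rightarrow> 'a \<Rightarrow> 'b \<Rightarrow> real" where
  "disp x y b = \<phi> y b - \<phi> x b"

lemma disp_eta: "disp x y = (\<lambda>b. \<phi> y b - \<phi> x b)"
  by (simp add: disp_def fun_eq_iff)

text \<open>An induced quadrangle \<open>x, y, w, z\<close> misses being a parallelogram by a vector of norm \<open>\<kappa>\<close>.\<close>

definition \<kappa> :: real where "\<kappa> = 2 * sqrt \<eta>"

lemma \<kappa>_nonneg: "\<kappa> \<ge> 0"
  by (simp add: \<kappa>_def \<eta>_nonneg)

lemma \<kappa>_power2: "\<kappa>\<^sup>2 = 4 * \<eta>"
  by (simp add: \<kappa>_def power_mult_distrib \<eta>_nonneg)

lemma m_square_\<kappa>: "real m ^ 2 * \<kappa> \<le> 3 / 5"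
proof -
  have "(real m ^ 2 * \<kappa>)\<^sup>2 = real m ^ 4 * (4 * \<eta>)"
    by (simp add: power_mult_distrib \<kappa>_power2 flip: power_mult)
  \<comment> \<open>By \<open>\<eta>_small\<close> the left side is at most 1/3, which is below
    9/25.\<close>
  also have "\<dots> \<le> (3/5)\<^sup>2"
    using \<eta>_small by (simp add: power2_eq_square)
  finally show ?thesis
    by (rule power2_le_imp_le) simp
qed

text \<open>Errors grow linearly with the dimension \<open>j\<close> of a box. As
  \<open>4 * (m - 1)\<close> is at most the square of \<open>m\<close>, the bound is a quarter of
  3/5.\<close>

lemma \<kappa>_mult_le: "j < m \<Longrightarrow> real j * \<kappa> \<le> 3 / 20"
proof -
  assume "j < m"
  have "4 * (real m - 1) \<le> (real m)\<^sup>2"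
    using zero_le_power2[of "real m - 2"] by (simp add: power2_eq_square algebra_simps)
  moreover have "real j \<le> real m - 1"
    using \<open>j < m\<close> by linarith
  ultimately have "4 * real j \<le> (real m)\<^sup>2"
    by (meson mult_left_mono order_trans zero_le_numeral)
  then have "4 * real j * \<kappa> \<le> (real m)\<^sup>2 * \<kappa>"
    by (intro mult_right_mono \<kappa>_nonneg)
  with m_square_\<kappa> show ?thesis
    by simp
qed

lemma \<kappa>_le: "\<kappa> \<le> 3 / 20"
  using \<kappa>_mult_le[of 1] m_ge by simp

lemma \<eta>_le: "\<eta> \<le> 1 / 100"
proof -
  have "\<kappa>\<^sup>2 \<le> (3/20)\<^sup>2"
    by (intro power_mono \<kappa>_le \<kappa>_nonneg)
  then have "4 * \<eta> \<le> (3/20)\<^sup>2"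
    unfolding \<kappa>_power2 .
  then show ?thesis
    by (simp add: power2_eq_square)
qed

lemma edge_in_V: "(x, y) \<in> E \<Longrightarrow> x \<in> V" "(x, y) \<in> E \<Longrightarrow> y \<in> V"
  using E_sub by auto

lemma norm_edge: "(x, y) \<in> E \<Longrightarrow> L2_set (disp x y) B = sqrt 2"
  using E_norm[OF E_sym, of x y] real_sqrt_unique[of "L2_set (disp x y) B" 2]
  by (simp add: disp_eta)

text \<open>Rational bounds let linear arithmetic compare the error sums with the distances.\<close>

lemma sqrt_2_bounds: "7/5 \<le> sqrt 2" "sqrt 2 \<le> 99/70"
proof -
  show "7/5 \<le> sqrt 2"
    by (rule real_le_rsqrt) (simp add: power2_eq_square)
  show "sqrt 2 \<le> 99/70"
    by (rule real_le_lsqrt) (simp_all add: power2_eq_square)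
qed

text \<open>Two neighbours of a vertex have distance 0, \<open>sqrt 2\<close> or nearly 2. The gaps
  exceed the errors below, so an approximate distance decides between equality, adjacency and
  nonadjacency. The value 199/100 has square at most 4 - 2/100.\<close>

lemma norm_near:
  assumes "(x, y) \<in> E" "(x, z) \<in> E"
  shows "y = z \<or> (y, z) \<in> E \<and> L2_set (disp y z) B = sqrt 2
    \<or> y \<noteq> z \<and> (y, z) \<notin> E \<and> L2_set (disp y z) B \<ge> 199/100"
proof -
  have "L2_set (disp y z) B \<ge> 199/100" if "y \<noteq> z" "(y, z) \<notin> E"
  proof (rule power2_le_imp_le)
    have "(L2_set (disp y z) B)\<^sup>2 = 4 - 2 * \<eta>"
      using nonedge_norm[OF assms that] L2_set_diff_commute[of "\<phi> y" "\<phi> z" B]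
      by (simp add: disp_eta)
    then show "(199/100)\<^sup>2 \<le> (L2_set (disp y z) B)\<^sup>2"
      using \<eta>_le by (simp add: power2_eq_square)
  qed auto
  then show ?thesis
    using norm_edge by blast
qed

lemma near_eq:
  assumes "(x, y) \<in> E" "(x, z) \<in> E" "L2_set (disp y z) B < 7/5"
  shows "y = z"
  using norm_near[OF assms(1,2)] assms(3) sqrt_2_bounds by auto

lemma near_edge:
  assumes "(x, y) \<in> E" "(x, z) \<in> E" "y \<noteq> z" "L2_set (disp y z) B < 199/100"
  shows "(y, z) \<in> E"
  using norm_near[OF assms(1,2)] assms(3,4) by auto

lemma far_transversal:
  assumes "(x, y) \<in> E" "(x, z) \<in> E" "L2_set (disp y z) B > 99/70"
  shows "y \<noteq> z \<and> (y, z) \<notin> E"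
proof -
  have "L2_set (disp y y) B = 0"
    by (simp add: disp_def L2_set_def)
  then show ?thesis
    using norm_near[OF assms(1,2)] assms(3) sqrt_2_bounds by auto
qed

text \<open>All sides have squared length 2 and both diagonals \<open>4 - 2 * \<eta>\<close>, the
  second because \<open>w\<close> is not adjacent to \<open>x\<close>; so the defect is
  \<open>8 - 2 * (4 - 2 * \<eta>) = 4 * \<eta>\<close> for either pair of opposite sides.\<close>

lemma fourth_vertex:
  assumes "(x, y) \<in> E" "(x, z) \<in> E" "y \<noteq> z" "(y, z) \<notin> E"
  obtains w where "(y, w) \<in> E" "(z, w) \<in> E"
    "L2_set (\<lambda>b. disp y w b - disp x z b) B \<le> \<kappa>"
    "L2_set (\<lambda>b. disp z w b - disp x y b) B \<le> \<kappa>"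
proof -
  from fourth[OF assms] obtain w where w: "(y, w) \<in> E" "(z, w) \<in> E" "w \<noteq> x" "(x, w) \<notin> E"
    by blast
  have n: "(L2_set (\<lambda>b. \<phi> p b - \<phi> q b) B)\<^sup>2 = 2" if "(p, q) \<in> E" for p q
    using E_norm that by blast
  have far: "(L2_set (\<lambda>b. \<phi> y b - \<phi> z b) B)\<^sup>2 = 4 - 2 * \<eta>"
    "(L2_set (\<lambda>b. \<phi> x b - \<phi> w b) B)\<^sup>2 = 4 - 2 * \<eta>"
    using nonedge_norm[OF assms] nonedge_norm[OF E_sym[OF assms(1)] w(1)] w by auto
  have far': "(L2_set (\<lambda>b. \<phi> z b - \<phi> y b) B)\<^sup>2 = 4 - 2 * \<eta>"
    "(L2_set (\<lambda>b. \<phi> w b - \<phi> x b) B)\<^sup>2 = 4 - 2 * \<eta>"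
    using far L2_set_diff_commute[of "\<phi> y" "\<phi> z" B] L2_set_diff_commute[of "\<phi> x" "\<phi> w" B]
    by simp_all
  note s = E_sym[OF w(1)] E_sym[OF w(2)] E_sym[OF assms(1)] E_sym[OF assms(2)]
  have "(L2_set (\<lambda>b. disp y w b - disp x z b) B)\<^sup>2 = \<kappa>\<^sup>2"
    unfolding disp_def L2_set_parallelogram[OF finite_B]
    using far far' n[OF s(1)] n[OF s(2)] n[OF s(3)] n[OF s(4)] by (simp add: \<kappa>_power2)
  moreover have "(L2_set (\<lambda>b. disp z w b - disp x y b) B)\<^sup>2 = \<kappa>\<^sup>2"
    unfolding disp_def L2_set_parallelogram[OF finite_B]
    using far far' n[OF s(1)] n[OF s(2)] n[OF s(3)] n[OF s(4)] by (simp add: \<kappa>_power2)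
  ultimately show ?thesis
    using that[OF w(1,2)] \<kappa>_nonneg by (metis L2_set_nonneg order_refl power2_eq_iff_nonneg)
qed

text \<open>Displacements along different lines through \<open>x\<^sub>0\<close> are nearly
  orthogonal and of length \<open>sqrt 2\<close>, so their difference has length near 2.\<close>

lemma L_other_norm:
  assumes "i < m" "j < m" "i \<noteq> j" "y < s" "z < s" "y \<noteq> z" "0 < u" "u < s"
  shows "L2_set (\<lambda>b. disp x\<^sub>0 (L j u) b - disp (L i y) (L i z) b) B \<ge> 199/100"
proof (rule power2_le_imp_le)
  have n: "(L2_set (\<lambda>b. \<phi> p b - \<phi> q b) B)\<^sup>2 = 2" if "(p, q) \<in> E" for p q
    using E_norm that by blast
  have far: "(L2_set (\<lambda>b. \<phi> (L i p) b - \<phi> (L j u) b) B)\<^sup>2 = 4 - 2 * \<eta>"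
    if "0 < p" "p < s" for p
  proof (rule nonedge_norm[of x\<^sub>0])
    show "(x\<^sub>0, L i p) \<in> E" "(x\<^sub>0, L j u) \<in> E"
      using L_same[of i 0 p] L_same[of j 0 u] L_0 assms that by auto
  qed (use L_other[of i j p u] assms that in auto)
  have far': "(L2_set (\<lambda>b. \<phi> (L j u) b - \<phi> (L i p) b) B)\<^sup>2 = 4 - 2 * \<eta>"
    if "0 < p" "p < s" for p
    using far[OF that] L2_set_diff_commute[of "\<phi> (L i p)" "\<phi> (L j u)" B] by simp
  have ju: "(L j u, x\<^sub>0) \<in> E"
    using L_same[of j u 0] L_0 assms by auto
  have x0: "(x\<^sub>0, L i p) \<in> E" if "0 < p" "p < s" for p
    using L_same[of i 0 p] L_0 assms that by auto
  have zy: "(L i z, L i y) \<in> E"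
    using L_same[of i z y] assms by auto
  have zero: "L2_set (\<lambda>b. \<phi> x\<^sub>0 b - \<phi> x\<^sub>0 b) B = 0"
    by (simp add: L2_set_def)
  show "(199/100)\<^sup>2 \<le> (L2_set (\<lambda>b. disp x\<^sub>0 (L j u) b - disp (L i y) (L i z) b) B)\<^sup>2"
  \<comment> \<open>The squared norm is \<open>4 - 2 * \<eta>\<close> for \<open>y = 0\<close>,
    \<open>4 + 2 * \<eta>\<close> for \<open>z = 0\<close>, and 4 otherwise.\<close>
  proof (cases "y = 0")
    case True
    then have "0 < z"
      using assms by auto
    then show ?thesis
      unfolding disp_def L2_set_parallelogram[OF finite_B]
      using far'[of z] n[OF ju] n[OF zy] n[OF x0[of z]] zero True L_0 assms \<eta>_le \<eta>_nonneg
      by (simp add: power2_eq_square)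
  next
    case y: False
    show ?thesis
    proof (cases "z = 0")
      case True
      then show ?thesis
        unfolding disp_def L2_set_parallelogram[OF finite_B]
        using far'[of y] n[OF ju] n[OF zy] n[OF x0[of y]] zero y L_0 assms \<eta>_le \<eta>_nonneg
        by (simp add: power2_eq_square)
    next
      case False
      then show ?thesis
        unfolding disp_def L2_set_parallelogram[OF finite_B]
        using far'[of y] far'[of z] n[OF ju] n[OF zy] n[OF x0[of y]] n[OF x0[of z]] y assms
        by (simp add: power2_eq_square)
    qed
  qed
qed auto

text \<open>A box realises the words of length \<open>j\<close> as vertices so that changing one letter moves the vector
  almost as it does on the corresponding line through \<open>x\<^sub>0\<close>. The error bound does not accumulate
  exponentially because an edge is carried through each new direction by one quadrangle.\<close>

definition box :: "nat \<Rightarrow> (nat list \<Rightarrow> 'a) \<Rightarrow> bool" where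
  "box j F \<longleftrightarrow> F (replicate j 0) = x\<^sub>0 \<and>
    (\<forall>ts\<in>words s j. F ts \<in> V \<and>
      (\<forall>i<j. \<forall>y<s. y \<noteq> ts ! i \<longrightarrow> (F ts, F (ts[i := y])) \<in> E \<and>
        L2_set (\<lambda>b. disp (F ts) (F (ts[i := y])) b - disp (L i (ts ! i)) (L i y) b) B
          \<le> 2 * real j * \<kappa>))"

text \<open>The displacements to \<open>g\<close> and to \<open>F (ts[i := y])\<close> are close to
  displacements along different lines through \<open>x\<^sub>0\<close>. The errors sum to at most
  \<open>3 * j * \<kappa> \<le> 9/20\<close>, and 199/100 - 9/20 still exceeds 99/70.\<close>

lemma box_transversal:
  assumes "box j F" "j < m" "ts \<in> words s j" "i < j" "y < s" "y \<noteq> ts ! i" "0 < u" "u < s"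
    and g: "(F ts, g) \<in> E"
      "L2_set (\<lambda>b. disp (F ts) g b - disp x\<^sub>0 (L j u) b) B \<le> real j * \<kappa>"
  shows "F (ts[i := y]) \<noteq> g \<and> (F (ts[i := y]), g) \<notin> E"
proof (rule far_transversal)
  let ?f = "F (ts[i := y])"
  have f: "(F ts, ?f) \<in> E"
    "L2_set (\<lambda>b. disp (F ts) ?f b - disp (L i (ts ! i)) (L i y) b) B \<le> 2 * real j * \<kappa>"
    using assms(1,3-6) by (auto simp: box_def)
  show "(F ts, ?f) \<in> E" "(F ts, g) \<in> E"
    by fact+
  have q: "L2_set (\<lambda>b. disp x\<^sub>0 (L j u) b - disp (L i (ts ! i)) (L i y) b) B \<ge> 199/100"
    using assms words_nth by (intro L_other_norm) auto
  have e: "L2_set (\<lambda>b. (disp (F ts) g b - disp x\<^sub>0 (L j u) b)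
      - (disp (F ts) ?f b - disp (L i (ts ! i)) (L i y) b)) B \<le> real j * \<kappa> + 2 * real j * \<kappa>"
    using g f by (intro L2_set_diff_le[OF refl]) auto
  have "L2_set (\<lambda>b. disp x\<^sub>0 (L j u) b - disp (L i (ts ! i)) (L i y) b) B
      \<le> L2_set (disp ?f g) B + (real j * \<kappa> + 2 * real j * \<kappa>)"
    by (rule L2_set_diff_le[OF _ order_refl e]) (simp add: disp_def)
  then show "L2_set (disp ?f g) B > 99/70"
    using q \<kappa>_mult_le[OF \<open>j < m\<close>] by simp
qed

text \<open>The edge from \<open>x\<^sub>0\<close> to \<open>L j u\<close> is carried along a path of quadrangles that introduces
  the letters of \<open>ts\<close> one after the other.\<close>

lemma box_translate:
  assumes "box j F" "j < m" "0 < u" "u < s" "ts \<in> words s j"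
  shows "\<exists>g. (F ts, g) \<in> E \<and>
    L2_set (\<lambda>b. disp (F ts) g b - disp x\<^sub>0 (L j u) b) B \<le> real j * \<kappa>"
proof -
  \<comment> \<open>Induction on the number of leading positions that may carry nonzero letters;
    each such letter costs one quadrangle, hence one \<open>\<kappa>\<close>.\<close>
  have "i \<le> j \<Longrightarrow> ts \<in> words s j \<Longrightarrow> (\<forall>l. i \<le> l \<and> l < j \<longrightarrow> ts ! l = 0) \<Longrightarrow>
    \<exists>g. (F ts, g) \<in> E \<and>
    L2_set (\<lambda>b. disp (F ts) g b - disp x\<^sub>0 (L j u) b) B \<le> real i * \<kappa>" for i ts
  proof (induction i arbitrary: ts)
    case 0
    have "ts = replicate j 0"
      using 0 by (intro nth_equalityI) (auto simp: words_def)
    then have "F ts = x\<^sub>0"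
      using assms(1) by (simp add: box_def)
    moreover have "(x\<^sub>0, L j u) \<in> E"
      using L_same[of j 0 u] L_0 assms by auto
    ultimately show ?case
      by (intro exI[of _ "L j u"]) (simp add: L2_set_def)
  next
    case (Suc i)
    let ?ts = "ts[i := 0]"
    have len: "length ts = j"
      using Suc.prems by (simp add: words_def)
    have "?ts \<in> words s j"
      using Suc.prems s_pos by (intro words_update) auto
    moreover have "\<forall>l. i \<le> l \<and> l < j \<longrightarrow> ?ts ! l = 0"
      using Suc.prems len by (auto simp: nth_list_update)
    ultimately obtain g where g: "(F ?ts, g) \<in> E"
      "L2_set (\<lambda>b. disp (F ?ts) g b - disp x\<^sub>0 (L j u) b) B \<le> real i * \<kappa>"
      using Suc.IH[of ?ts] Suc.prems by auto
    show ?case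
    proof (cases "ts ! i = 0")
      case True
      then have "?ts = ts"
        by (metis list_update_id)
      with g show ?thesis
        using \<kappa>_nonneg by (intro exI[of _ g]) (auto simp: algebra_simps)
    next
      case False
      have i: "i < j"
        using Suc.prems by simp
      have ts: "?ts[i := ts ! i] = ts"
        by simp
      have "real i * \<kappa> \<le> real j * \<kappa>"
        using i \<kappa>_nonneg by (intro mult_right_mono) auto
      with g(2) have g2: "L2_set (\<lambda>b. disp (F ?ts) g b - disp x\<^sub>0 (L j u) b) B \<le> real j * \<kappa>"
        by linarith
      have lt: "ts ! i < s" "ts ! i \<noteq> ?ts ! i"
        using words_nth[OF Suc.prems(2) i] False i len by auto
      have tr: "F ts \<noteq> g \<and> (F ts, g) \<notin> E"
        using box_transversal[OF assms(1,2) \<open>?ts \<in> words s j\<close> i lt assms(3,4) g(1) g2] ts by simp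
      have e: "(F ?ts, F ts) \<in> E"
        using assms(1) \<open>?ts \<in> words s j\<close> i lt ts unfolding box_def by metis
      \<comment> \<open>This quadrangle carries the edge to \<open>g\<close> across the change of
        letter \<open>i\<close>.\<close>
      obtain w where w: "(F ts, w) \<in> E"
        "L2_set (\<lambda>b. disp (F ts) w b - disp (F ?ts) g b) B \<le> \<kappa>"
        using fourth_vertex[OF e g(1)] tr by blast
      have "L2_set (\<lambda>b. disp (F ts) w b - disp x\<^sub>0 (L j u) b) B \<le> \<kappa> + real i * \<kappa>"
        by (rule L2_set_add_le[OF _ w(2) g(2)]) simp
      with w(1) show ?thesis
        by (intro exI[of _ w]) (auto simp: algebra_simps)
    qed
  qed
  from this[of j ts] assms show ?thesis
    by simp
qed

text \<open>The new letter \<open>u\<close> selects a translate \<open>G u\<close> of the old box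
  along line \<open>j\<close>. Comparing two translates, each off by at most
  \<open>j * \<kappa>\<close>, explains the factor 2 in the error bound of
  \<open>box\<close>.\<close>

lemma box_extend:
  assumes F: "box j F" and j: "j < m"
  shows "\<exists>F'. box (Suc j) F'"
proof -
  \<comment> \<open>The conditional lets one choice function contain the old box as
    \<open>G 0\<close>.\<close>
  have "\<exists>G. \<forall>u ts. u < s \<and> ts \<in> words s j \<longrightarrow>
     (if u = 0 then G u ts = F ts else (F ts, G u ts) \<in> E \<and>
        L2_set (\<lambda>b. disp (F ts) (G u ts) b - disp x\<^sub>0 (L j u) b) B \<le> real j * \<kappa>)"
    by (intro choice allI) (use box_translate[OF F j] in auto)
  then obtain G where G0: "\<And>ts. ts \<in> words s j \<Longrightarrow> G 0 ts = F ts"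
    and G: "\<And>u ts. 0 < u \<Longrightarrow> u < s \<Longrightarrow> ts \<in> words s j \<Longrightarrow> (F ts, G u ts) \<in> E"
    and Ge: "\<And>u ts. 0 < u \<Longrightarrow> u < s \<Longrightarrow> ts \<in> words s j \<Longrightarrow>
        L2_set (\<lambda>b. disp (F ts) (G u ts) b - disp x\<^sub>0 (L j u) b) B \<le> real j * \<kappa>"
    using s_pos by (metis less_irrefl)
  note small = \<kappa>_mult_le[OF j] \<kappa>_le \<kappa>_nonneg
  have jk: "0 \<le> real j * \<kappa>"
    using \<kappa>_nonneg by simp
  have FV: "F ts \<in> V" if "ts \<in> words s j" for ts
    using F that by (auto simp: box_def)
  have Fe: "(F ts, F (ts[i := y])) \<in> E"
      "L2_set (\<lambda>b. disp (F ts) (F (ts[i := y])) b - disp (L i (ts ! i)) (L i y) b) B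
          \<le> 2 * real j * \<kappa>"
    if "ts \<in> words s j" "i < j" "y < s" "y \<noteq> ts ! i" for ts i y
    using F that by (auto simp: box_def)
  have old: "(G u ts, G u (ts[i := y])) \<in> E \<and>
      L2_set (\<lambda>b. disp (G u ts) (G u (ts[i := y])) b - disp (L i (ts ! i)) (L i y) b) B
          \<le> 2 * real (Suc j) * \<kappa>"
    if u: "u < s" and ts: "ts \<in> words s j" and i: "i < j" "y < s" "y \<noteq> ts ! i" for u ts i y
  proof -
    let ?ts = "ts[i := y]"
    have ts': "?ts \<in> words s j"
      using ts i by (intro words_update)
    show ?thesis
    proof (cases "u = 0")
      case True
      with Fe[OF ts i] G0 ts ts' jk \<kappa>_nonneg show ?thesis
        by (auto simp: algebra_simps)
    next
      case False
      then have u: "0 < u" "u < s"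
        using u by auto
      note g = G[OF u ts] Ge[OF u ts] and g' = G[OF u ts'] Ge[OF u ts']
      have "F ?ts \<noteq> G u ts \<and> (F ?ts, G u ts) \<notin> E"
        using box_transversal[OF F j ts i u g] .
      then obtain w where w: "(F ?ts, w) \<in> E" "(G u ts, w) \<in> E"
        "L2_set (\<lambda>b. disp (F ?ts) w b - disp (F ts) (G u ts) b) B \<le> \<kappa>"
        "L2_set (\<lambda>b. disp (G u ts) w b - disp (F ts) (F ?ts) b) B \<le> \<kappa>"
        using fourth_vertex[OF Fe(1)[OF ts i] g(1)] by blast
      \<comment> \<open>Both are neighbours of \<open>F ?ts\<close> with nearly the same
        displacement; their distance is at most \<open>(2 * j + 1) * \<kappa>\<close>, below the
        least distance of distinct neighbours. Hence translations commute exactly.\<close>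
      have "w = G u ?ts"
      proof (rule near_eq[OF w(1) g'(1)])
        have e: "L2_set (\<lambda>b. disp (F ?ts) w b - disp x\<^sub>0 (L j u) b) B \<le> \<kappa> + real j * \<kappa>"
          by (rule L2_set_add_le[OF _ w(3) g(2)]) simp
        have "L2_set (disp w (G u ?ts)) B \<le> real j * \<kappa> + (\<kappa> + real j * \<kappa>)"
          by (rule L2_set_diff_le[OF _ g'(2) e]) (simp add: disp_def)
        then show "L2_set (disp w (G u ?ts)) B < 7/5"
          using small by simp
      qed
      \<comment> \<open>The other pair of opposite sides adds one \<open>\<kappa>\<close> to the old
        error, within the increase \<open>2 * \<kappa>\<close> allowed for dimension
        \<open>Suc j\<close>.\<close>
      moreover have "L2_set (\<lambda>b. disp (G u ts) w b - disp (L i (ts ! i)) (L i y) b) B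
          \<le> \<kappa> + 2 * real j * \<kappa>"
        by (rule L2_set_add_le[OF _ w(4) Fe(2)[OF ts i]]) simp
      ultimately show ?thesis
        using w(2) \<kappa>_nonneg by (auto simp: algebra_simps)
    qed
  qed
  have e0: "L2_set (\<lambda>b. disp (F ts) (G u ts) b - disp x\<^sub>0 (L j u) b) B \<le> real j * \<kappa>"
    if "u < s" "ts \<in> words s j" for u ts
  proof (cases "u = 0")
    case True
    then have "L2_set (\<lambda>b. disp (F ts) (G u ts) b - disp x\<^sub>0 (L j u) b) B = 0"
      using G0 that L_0[OF j] by (simp add: disp_def L2_set_def)
    then show ?thesis
      using jk by simp
  next
    case False
    then show ?thesis
      using Ge that by simp
  qed
  have new: "(G u ts, G y ts) \<in> E \<and>
      L2_set (\<lambda>b. disp (G u ts) (G y ts) b - disp (L j u) (L j y) b) B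
          \<le> 2 * real (Suc j) * \<kappa>"
    if ts: "ts \<in> words s j" and uy: "u < s" "y < s" "y \<noteq> u" for u ts y
  proof -
    have e: "L2_set (\<lambda>b. disp (G u ts) (G y ts) b - disp (L j u) (L j y) b) B
        \<le> real j * \<kappa> + real j * \<kappa>"
      by (rule L2_set_diff_le[OF _ e0[OF uy(2) ts] e0[OF uy(1) ts]]) (simp add: disp_def)
    \<comment> \<open>For nonzero letters both are neighbours of \<open>F ts\<close>, at a distance
      within \<open>2 * j * \<kappa>\<close> of \<open>sqrt 2\<close>, so strictly between 0 and
      199/100; only adjacency remains.\<close>
    have "(G u ts, G y ts) \<in> E"
    proof (cases "u = 0 \<or> y = 0")
      case True
      then show ?thesis
        using G[of u ts] G[of y ts] G0 ts uy E_sym by auto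
    next
      case False
      then have gs: "(F ts, G u ts) \<in> E" "(F ts, G y ts) \<in> E"
        using G ts uy by auto
      have L: "L2_set (disp (L j u) (L j y)) B = sqrt 2"
        using L_same[OF j] uy by (intro norm_edge) auto
      have "L2_set (disp (G u ts) (G y ts)) B \<le> (real j * \<kappa> + real j * \<kappa>) + sqrt 2"
        by (rule L2_set_add_le[OF _ e eq_refl[OF L]]) simp
      then have lt: "L2_set (disp (G u ts) (G y ts)) B < 199/100"
        using small sqrt_2_bounds by simp
      have "sqrt 2 \<le> L2_set (disp (G u ts) (G y ts)) B + (real j * \<kappa> + real j * \<kappa>)"
        unfolding L[symmetric] by (rule L2_set_diff_le[OF _ order_refl e]) simp
      then have "L2_set (disp (G u ts) (G y ts)) B > 0"
        using small sqrt_2_bounds by simp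
      then have "G u ts \<noteq> G y ts"
        by (auto simp: disp_def L2_set_def)
      then show ?thesis
        using near_edge[OF gs] lt by blast
    qed
    with e show ?thesis
      using \<kappa>_nonneg by (auto simp: algebra_simps)
  qed
  define F' where "F' ts = G (last ts) (butlast ts)" for ts
  have F': "F' (ts @ [u]) = G u ts" for ts u
    by (simp add: F'_def)
  have "box (Suc j) F'"
    unfolding box_def
  proof (intro conjI ballI allI impI)
    have "replicate j 0 \<in> words s j"
      using s_pos by (auto simp: words_def)
    then show "F' (replicate (Suc j) 0) = x\<^sub>0"
      using G0 F F' unfolding box_def replicate_Suc replicate_append_same[symmetric] by metis
  next
    fix ts assume "ts \<in> words s (Suc j)"
    then obtain us u where us: "us \<in> words s j" "u < s" "ts = us @ [u]"
      by (auto simp: words_Suc)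
    show "F' ts \<in> V"
      using us F' G[of u us] G0 FV edge_in_V(2) by (cases "u = 0") auto
    fix i y assume i: "i < Suc j" "y < s" "y \<noteq> ts ! i"
    have len: "length us = j"
      using us by (simp add: words_def)
    show "(F' ts, F' (ts[i := y])) \<in> E" 
      "L2_set (\<lambda>b. disp (F' ts) (F' (ts[i := y])) b - disp (L i (ts ! i)) (L i y) b) B
          \<le> 2 * real (Suc j) * \<kappa>"
      using i us F' len new[OF us(1,2) i(2)] old[OF us(2,1) _ i(2), of i]
      by (cases "i = j"; simp add: list_update_append nth_append)+
  qed
  then show ?thesis
    by blast
qed

lemma box_exists: "j \<le> m \<Longrightarrow> \<exists>F. box j F"
proof (induction j)
  case 0
  have "box 0 (\<lambda>_. x\<^sub>0)"
    using base by (simp add: box_def)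
  then show ?case
    by blast
next
  case (Suc j)
  then show ?case
    using box_extend by auto
qed

section \<open>Injectivity of the coordinates\<close>

lemma inner_other:
  assumes "i < m" "j < m" "i \<noteq> j" "y < s" "z < s" "y \<noteq> z" "u < s" "v < s" "u \<noteq> v"
  shows "(\<Sum>b\<in>B. disp (L i y) (L i z) b * disp (L j u) (L j v) b) \<ge> - \<eta>"
proof -
  define dd where "dd p q = (L2_set (\<lambda>b. \<phi> p b - \<phi> q b) B)\<^sup>2" for p q
  have id: "(\<Sum>b\<in>B. disp p q b * disp p' q' b) = (dd p q' + dd q p' - dd p p' - dd q q') / 2"
    for p q p' q'
    unfolding dd_def L2_set_power2[OF finite_B] sum.distrib[symmetric] sum_subtractf[symmetric]
      sum_divide_distrib disp_def
    by (intro sum.cong refl) (simp add: power2_eq_square field_simps)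
  have x0: "(x\<^sub>0, L l p) \<in> E" if "0 < p" "p < s" "l < m" for p l
    using L_same[of l 0 p] L_0 that by auto
  have dd: "dd (L i p) (L j q) = (if p = 0 then (if q = 0 then 0 else 2) else
      (if q = 0 then 2 else 4 - 2 * \<eta>))" if "p < s" "q < s" for p q
  proof (cases "p = 0 \<or> q = 0")
    case True
    then show ?thesis
      using that assms L_0 E_norm[OF x0] E_norm[OF E_sym[OF x0]]
      by (auto simp: dd_def L2_set_def)
  next
    case False
    then show ?thesis
      unfolding dd_def using that assms L_other[of i j p q] nonedge_norm[OF x0 x0, of p i q j] by simp
  qed
  \<comment> \<open>Depending on which labels are 0, the inner product is \<eta>, 0 or
    -\<eta>.\<close>
  show ?thesis
    unfolding id using assms \<eta>_nonneg by (auto simp: dd)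
qed

lemma inner_self:
  assumes "(x, y) \<in> E"
  shows "(\<Sum>b\<in>B. disp x y b * disp x y b) = 2"
  using E_norm[OF E_sym[OF assms]]
  by (simp add: L2_set_power2[OF finite_B] disp_def flip: power2_eq_square)

text \<open>The word \<open>ts\<close> is changed into \<open>us\<close> letter by letter and the
  total displacement is projected onto \<open>p\<close>, taken from a line whose letter differs.
  That letter contributes almost 2 and the others are almost nonnegative, so the end points
  differ.\<close>

lemma box_inj:
  assumes F: "box m F"
  shows "inj_on F (words s m)"
proof (rule inj_onI, rule ccontr)
  fix ts us assume ts: "ts \<in> words s m" and us: "us \<in> words s m" and eq: "F ts = F us" and "ts \<noteq> us"
  have len: "length ts = m" "length us = m"
    using ts us by (auto simp: words_def)
  with \<open>ts \<noteq> us\<close> obtain i where i: "i < m" "ts ! i \<noteq> us ! i"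
    by (metis nth_equalityI)
  define p where "p = disp (L i (ts ! i)) (L i (us ! i))"
  define ip where "ip f = (\<Sum>b\<in>B. p b * f b)" for f
  \<comment> \<open>The loss per letter: \<eta> from the lack of orthogonality, and by
    Cauchy-Schwarz the norm \<open>sqrt 2\<close> of \<open>p\<close> times the box error.\<close>
  define e where "e = \<eta> + sqrt 2 * (2 * real m * \<kappa>)"
  have pe: "(L i (ts ! i), L i (us ! i)) \<in> E"
    using i ts us words_nth by (intro L_same) auto
  have e_nonneg: "e \<ge> 0"
    using \<eta>_nonneg \<kappa>_nonneg by (simp add: e_def)
  define w where "w l = take l us @ drop l ts" for l
  have w: "w l \<in> words s m" if "l \<le> m" for l
    using ts us that by (auto simp: w_def words_def dest: in_set_takeD in_set_dropD)
  have step: "w (Suc l) = (w l)[l := us ! l]" "w l ! l = ts ! l" if "l < m" for l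
  proof -
    have "drop l ts = ts ! l # drop (Suc l) ts"
      using that len by (simp add: Cons_nth_drop_Suc)
    then show "w (Suc l) = (w l)[l := us ! l]" "w l ! l = ts ! l"
      using that len by (auto simp: w_def take_Suc_conv_app_nth list_update_append nth_append)
  qed
  have "ip (disp (F ts) (F (w l))) \<ge> (if i < l then 2 else 0) - real l * e" if "l \<le> m" for l
    using that
  proof (induction l)
    case 0
    have "w 0 = ts"
      by (simp add: w_def)
    then show ?case
      by (simp add: ip_def disp_def)
  next
    case (Suc l)
    then have l: "l < m" "l \<le> m" by auto
    have split: "ip (disp (F ts) (F (w (Suc l)))) = ip (disp (F ts) (F (w l)))
        + ip (disp (F (w l)) (F (w (Suc l))))"
      by (simp add: ip_def disp_def sum.distrib[symmetric] algebra_simps)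
    have main: "ip (disp (F (w l)) (F (w (Suc l)))) \<ge> (if i = l then 2 else 0) - e"
    proof (cases "us ! l = ts ! l")
      case True
      then have "w (Suc l) = w l"
        using step[OF l(1)] by (metis list_update_id)
      then show ?thesis
        using True i e_nonneg by (auto simp: ip_def disp_def)
    next
      case False
      have lt: "us ! l < s" "ts ! l < s"
        using ts us words_nth l by auto
      let ?d = "\<lambda>b. disp (F (w l)) (F (w (Suc l))) b - disp (L l (ts ! l)) (L l (us ! l)) b"
      have "L2_set ?d B \<le> 2 * real m * \<kappa>"
        using F[unfolded box_def, THEN conjunct2, rule_format, OF w[OF l(2)], THEN conjunct2,
            rule_format, OF l(1) lt(1)] step[OF l(1)] False by simp
      then have "L2_set p B * L2_set ?d B \<le> sqrt 2 * (2 * real m * \<kappa>)"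
        unfolding p_def norm_edge[OF pe] by (intro mult_left_mono) auto
      then have d: "\<bar>ip ?d\<bar> \<le> sqrt 2 * (2 * real m * \<kappa>)"
        unfolding ip_def using sum_mult_le_L2_set[of p ?d B] by linarith
      have "ip (disp (F (w l)) (F (w (Suc l)))) = ip (disp (L l (ts ! l)) (L l (us ! l))) + ip ?d"
        by (simp add: ip_def sum.distrib[symmetric] algebra_simps)
      moreover have "ip (disp (L l (ts ! l)) (L l (us ! l))) \<ge> (if i = l then 2 else 0) - \<eta>"
        using inner_self[OF pe] inner_other[of i l "ts ! i" "us ! i" "ts ! l" "us ! l"] lt False i
          ts us words_nth l \<eta>_nonneg
        unfolding ip_def p_def by auto
      ultimately show ?thesis
        using d unfolding e_def by linarith
    qed
    have "real (Suc l) * e = real l * e + e"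
      by (simp add: algebra_simps)
    then show ?case
      using split main Suc.IH[OF l(2)] by (auto split: if_splits)
  qed
  from this[of m] have "ip (disp (F ts) (F us)) \<ge> 2 - real m * e"
    using i len by (simp add: w_def)
  then have "real m * e \<ge> 2"
    using eq by (simp add: ip_def disp_def)
  \<comment> \<open>In total \<open>m * e\<close> is at most 1/12 + (99/35) * (3/5), which is below
    2.\<close>
  moreover have "real m * \<eta> \<le> 1 / 12"
  proof -
    have "real m * 1 \<le> real m * real m ^ 3"
      using m_ge by (intro mult_left_mono one_le_power) auto
    then have "real m \<le> real m ^ 4"
      by (simp add: eval_nat_numeral)
    then have "real m * \<eta> \<le> real m ^ 4 * \<eta>"
      using \<eta>_nonneg by (intro mult_right_mono)
    then show ?thesis
      using \<eta>_small by simp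
  qed
  moreover have "real m * (sqrt 2 * (2 * real m * \<kappa>)) = 2 * sqrt 2 * (real m ^ 2 * \<kappa>)"
    by (simp add: power2_eq_square)
  moreover have "2 * sqrt 2 * (real m ^ 2 * \<kappa>) \<le> (2 * 99/70) * (3/5)"
    using m_square_\<kappa> sqrt_2_bounds \<kappa>_nonneg by (intro mult_mono) auto
  ultimately show False
    by (simp add: e_def distrib_left)
qed

section \<open>Surjectivity by counting neighbours\<close>

lemma card_word_neighbours:
  assumes "ts \<in> words s m"
  shows "card {ts[i := y] | i y. i < m \<and> y < s \<and> y \<noteq> ts ! i} = m * (s - 1)"
proof -
  let ?P = "Sigma {..<m} (\<lambda>i. {..<s} - {ts ! i})"
  have len: "length ts = m"
    using assms by (simp add: words_def)
  have "{ts[i := y] | i y. i < m \<and> y < s \<and> y \<noteq> ts ! i} = (\<lambda>(i, y). ts[i := y]) ` ?P"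
    by auto
  moreover have "inj_on (\<lambda>(i, y). ts[i := y]) ?P"
  proof (rule inj_onI)
    fix p q assume p: "p \<in> ?P" and q: "q \<in> ?P"
      and eq: "(\<lambda>(i, y). ts[i := y]) p = (\<lambda>(i, y). ts[i := y]) q"
    obtain i y j z where pq: "p = (i, y)" "q = (j, z)"
      by (cases p, cases q)
    then have "ts[i := y] ! i = ts[j := z] ! i"
      using eq by simp
    then have "i = j" "y = z"
      using p q pq len by (auto simp: nth_list_update split: if_splits)
    then show "p = q"
      using pq by simp
  qed
  moreover have "card ?P = m * (s - 1)"
    using words_nth[OF assms] by (simp add: card_SigmaI)
  ultimately show ?thesis
    by (simp add: card_image)
qed

text \<open>By injectivity the \<open>m * (s - 1)\<close> one-letter changes of a word give distinct
  neighbours, which exhaust the degree. So the image is closed under adjacency and is all of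
  \<open>V\<close>.\<close>

theorem Hamming_coordinates:
  obtains F where "bij_betw F (words s m) V"
    "\<And>ts x. ts \<in> words s m \<Longrightarrow>
      (F ts, x) \<in> E \<longleftrightarrow> (\<exists>i<m. \<exists>y<s. y \<noteq> ts ! i \<and> x = F (ts[i := y]))"
proof -
  obtain F where F: "box m F"
    using box_exists by blast
  have inj: "inj_on F (words s m)"
    using box_inj[OF F] .
  have nb: "{x. (F ts, x) \<in> E} = F ` {ts[i := y] | i y. i < m \<and> y < s \<and> y \<noteq> ts ! i}"
    (is "?N = F ` ?W") if ts: "ts \<in> words s m" for ts
  proof (rule sym, rule card_subset_eq)
    have W: "?W \<subseteq> words s m"
      using ts words_update by blast
    show "finite ?N"
      by (rule finite_subset[OF _ finite_V]) (use E_sub in auto)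
    show "F ` ?W \<subseteq> ?N"
      using F ts by (auto simp: box_def)
    have "card (F ` ?W) = card ?W"
      using inj W by (meson card_image inj_on_subset)
    then show "card (F ` ?W) = card ?N"
      using card_word_neighbours[OF ts] E_degree[of "F ts"] F ts by (simp add: box_def)
  qed
  have "F ` words s m = V"
  proof (rule E_connected)
    show "F ` words s m \<subseteq> V"
      using F by (auto simp: box_def)
    have "replicate m 0 \<in> words s m"
      using s_pos by (auto simp: words_def)
    then show "x\<^sub>0 \<in> F ` words s m"
      using F by (metis box_def image_eqI)
    fix x y assume "x \<in> F ` words s m" "(x, y) \<in> E"
    then obtain ts where ts: "ts \<in> words s m" "(F ts, y) \<in> E"
      by auto
    then have "y \<in> F ` {ts[i := y] | i y. i < m \<and> y < s \<and> y \<noteq> ts ! i}"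
      using nb by blast
    then show "y \<in> F ` words s m"
      using words_update[OF ts(1)] by blast
  qed
  with inj have "bij_betw F (words s m) V"
    by (simp add: bij_betw_def)
  moreover have "(F ts, x) \<in> E \<longleftrightarrow> (\<exists>i<m. \<exists>y<s. y \<noteq> ts ! i \<and> x = F (ts[i := y]))"
    if "ts \<in> words s m" for ts x
    using nb[OF that] by blast
  ultimately show ?thesis
    using that by blast
qed

end

section \<open>The Hamming structure\<close>

text \<open>Condition \<open>single\<close> makes the neighbours of a vertex a disjoint union of
  cliques, one for each line; \<open>c_2\<close> supplies the quadrangles.\<close>

locale disjoint_lines_drg = geometric_drg +
  assumes single: "\<lbrakk>C \<in> lines; x \<notin> C; y \<in> C; z \<in> C; (x, y) \<in> E; (x, z) \<in> E\<rbrakk> \<Longrightarrow> y = z"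
    and c_2: "c 2 \<ge> 2"
begin

text \<open>Otherwise \<open>x\<close> and \<open>y\<close> would be two neighbours of
  \<open>z\<close> on a line missing \<open>z\<close>.\<close>

lemma triangle_in_line:
  assumes "(x, y) \<in> E" "(x, z) \<in> E" "(y, z) \<in> E" "C \<in> lines" "x \<in> C" "y \<in> C"
  shows "z \<in> C"
proof (rule ccontr)
  assume "z \<notin> C"
  then have "x = y"
    using single[of C z x y] assms E_sym by blast
  then show False
    using assms E_irrefl by blast
qed

text \<open>The common neighbours of the ends of an edge are the other vertices of its line.\<close>

lemma a_1: "a 1 = n - 1"
proof -
  obtain x y where xy: "(x, y) \<in> E"
    by (rule edge_exists)
  then obtain C where C: "C \<in> lines" "x \<in> C" "y \<in> C"
    using line_unique by blast
  have V: "x \<in> V" "y \<in> V"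
    using xy E_in_V by blast+
  have "{z. (y, z) \<in> E \<and> gdist x z = 1} = C - {x, y}"
  proof (intro equalityI subsetI)
    fix z assume "z \<in> {z. (y, z) \<in> E \<and> gdist x z = 1}"
    then have z: "(y, z) \<in> E" "(x, z) \<in> E"
      using gdist_1_iff[OF V(1)] E_in_V by auto
    then show "z \<in> C - {x, y}"
      using triangle_in_line[OF xy z(2,1) C] E_irrefl by blast
  next
    fix z assume z: "z \<in> C - {x, y}"
    then have "(y, z) \<in> E" "(x, z) \<in> E"
      using line_edge[OF C(1)] C by blast+
    then show "z \<in> {z. (y, z) \<in> E \<and> gdist x z = 1}"
      using gdist_1_iff[OF V(1)] E_in_V by blast
  qed
  moreover have "gdist x y = 1"
    using gdist_1_iff[OF V] xy by blast
  ultimately have "a 1 = card (C - {x, y})"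
    using card_a[OF V] by simp
  also have "x \<noteq> y"
    using xy E_irrefl by blast
  then have "card (C - {x, y}) = n - 1"
    using C line_finite[OF C(1)] card_line[OF C(1)] by (simp add: card_Diff_subset)
  finally show ?thesis .
qed

text \<open>The degree splits as \<open>c 1 + a 1 + b 1 = 1 + (n - 1) + b 1\<close>; real numbers
  avoid truncated subtraction.\<close>

lemma b_1: "real (b 1) = real (b 0) - real n"
proof -
  obtain x y where xy: "(x, y) \<in> E"
    by (rule edge_exists)
  have V: "x \<in> V" "y \<in> V"
    using xy E_in_V by blast+
  have "gdist x y = 1"
    using gdist_1_iff[OF V] xy by blast
  have "(y, x) \<in> E"
    using E_sym xy .
  then have "{z. (y, z) \<in> E \<and> gdist x z = 0} = {x}"
    using gdist_0D[OF V(1)] E_in_V(2)[of y] V(1) by auto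
  then have c1: "c 1 = 1"
    using card_c[OF V, of 0] \<open>gdist x y = 1\<close> by simp
  have "real (b 0) = (\<Sum>z\<in>neighbors X y. 1)"
    using degree[OF V(2)] by simp
  also have "\<dots> = (\<Sum>i\<le>d. real (int_num i 1))"
    using sum_neighbors_by_distance[OF V, of "\<lambda>_. 1"] \<open>gdist x y = 1\<close> by simp
  also have "\<dots> = (\<Sum>i\<in>{0,1,2}. real (int_num i 1))"
    using d_ge_2 by (intro sum.mono_neutral_right) (auto simp: int_num_def)
  also have "\<dots> = 1 + real (a 1) + real (b 1)"
    using c1 by (simp add: int_num_def numeral_2_eq_2)
  finally show ?thesis
    using a_1 n_pos by simp
qed

lemma b_1_pos: "b 1 > 0"
proof -
  obtain x y where xy: "x \<in> V" "y \<in> V" "gdist x y = 2"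
    using distance_attained d_ge_2 by blast
  then obtain z where z: "z \<in> V" "(z, y) \<in> E" "gdist x z = 1"
    using gdist_pred[of x y 1] by auto
  have "y \<in> {w. (z, w) \<in> E \<and> gdist x w = Suc 1}"
    using z xy by auto
  moreover have "finite {w. (z, w) \<in> E \<and> gdist x w = Suc 1}"
    by (rule finite_subset[OF _ finite_neighbors[of z]]) auto
  ultimately show ?thesis
    unfolding card_b[OF xy(1) z(1,3), symmetric] by (auto simp: card_gt_0_iff)
qed

text \<open>As \<open>c 2 \<ge> 2\<close>, there is a second common neighbour \<open>w\<close> of
  \<open>y\<close> and \<open>z\<close>. If it were adjacent to \<open>x\<close>, both
  \<open>y\<close> and \<open>z\<close> would lie on the line through \<open>x\<close> and
  \<open>w\<close> and be adjacent.\<close>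

lemma fourth_vertex_exists:
  assumes "(x, y) \<in> E" "(x, z) \<in> E" "y \<noteq> z" "(y, z) \<notin> E"
  shows "\<exists>w. (y, w) \<in> E \<and> (z, w) \<in> E \<and> w \<noteq> x \<and> (x, w) \<notin> E"
proof -
  have V: "x \<in> V" "y \<in> V" "z \<in> V"
    using assms E_in_V by blast+
  have "gdist y z = 2"
    using gdist_2_iff[OF V(2,3)] assms E_sym by blast
  then have "card {w. (z, w) \<in> E \<and> gdist y w = 1} \<ge> 2"
    using card_c[OF V(2,3), of 1] c_2 by (simp add: numeral_2_eq_2)
  then have "\<not> {w. (z, w) \<in> E \<and> gdist y w = 1} \<subseteq> {x}"
    using card_mono[of "{x}" "{w. (z, w) \<in> E \<and> gdist y w = 1}"] by auto
  then obtain w where w: "(z, w) \<in> E" "gdist y w = 1" "w \<noteq> x"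
    by blast
  then have yw: "(y, w) \<in> E"
    using gdist_1_iff[OF V(2)] E_in_V by blast
  have "(x, w) \<notin> E"
  proof
    assume xw: "(x, w) \<in> E"
    then obtain C where C: "C \<in> lines" "x \<in> C" "w \<in> C"
      using line_unique by blast
    have "y \<in> C" "z \<in> C"
      using triangle_in_line[OF xw _ _ C] assms yw w E_sym by blast+
    then show False
      using line_edge[OF C(1)] assms by blast
  qed
  with w yw show ?thesis
    by blast
qed

text \<open>Provides the labels \<open>L\<close> for \<open>parallelogram_graph\<close>: on each
  line the other vertices get 1 to \<open>n\<close>, and 0 is kept for \<open>x\<close>.\<close>

lemma line_labelling:
  assumes x: "x \<in> V"
  obtains L :: "nat \<Rightarrow> nat \<Rightarrow> 'a" and M where
    "real M = m" "\<And>i. i < M \<Longrightarrow> L i 0 = x"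
    "\<And>i p q. \<lbrakk>i < M; p < Suc n; q < Suc n; p \<noteq> q\<rbrakk> \<Longrightarrow> (L i p, L i q) \<in> E"
    "\<And>i j p q. \<lbrakk>i < M; j < M; i \<noteq> j; 0 < p; p < Suc n; 0 < q; q < Suc n\<rbrakk>
      \<Longrightarrow> L i p \<noteq> L j q \<and> (L i p, L j q) \<notin> E"
proof -
  define M where "M = card (lines_at x)"
  obtain C where C: "bij_betw C {..<M} (lines_at x)"
    using ex_bij_betw_nat_finite[OF finite_lines_at] by (auto simp: M_def lessThan_atLeast0)
  have Cl: "C i \<in> lines" "x \<in> C i" if "i < M" for i
    using bij_betwE[OF C] that by (auto simp: lines_at_def)
  have "\<exists>h. bij_betw h {1..n} (C i - {x})" if "i < M" for i
    using ex_bij_betw_nat_finite_1[of "C i - {x}"] line_finite[OF Cl(1)] card_line[OF Cl(1)] Cl(2) that by simp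
  then obtain h where h: "\<And>i. i < M \<Longrightarrow> bij_betw (h i) {1..n} (C i - {x})"
    by metis
  define L where "L i p = (if p = 0 then x else h i p)" for i p
  have LC: "L i p \<in> C i - {x}" if "i < M" "0 < p" "p < Suc n" for i p
    using bij_betwE[OF h[OF that(1)]] that by (auto simp: L_def)
  have LC': "L i p \<in> C i" if "i < M" "p < Suc n" for i p
    using LC[of i p] Cl(2) that by (cases "p = 0") (auto simp: L_def)
  have L_inj: "L i p \<noteq> L i q" if "i < M" "p < Suc n" "q < Suc n" "p \<noteq> q" for i p q
  proof (cases "p = 0 \<or> q = 0")
    case True
    then show ?thesis
      using LC[of i p] LC[of i q] that by (auto simp: L_def)
  next
    case False
    then show ?thesis
      using inj_on_eq_iff[OF bij_betw_imp_inj_on[OF h[OF that(1)]], of p q] that by (simp add: L_def)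
  qed
  show ?thesis
  proof (rule that[of M L])
    show "real M = m"
      using card_lines_at[OF x] by (simp add: M_def)
    show "L i 0 = x" for i
      by (simp add: L_def)
    show "(L i p, L i q) \<in> E" if "i < M" "p < Suc n" "q < Suc n" "p \<noteq> q" for i p q
      using line_edge[OF Cl(1)[OF that(1)] LC' LC' L_inj] that by blast
    show "L i p \<noteq> L j q \<and> (L i p, L j q) \<notin> E"
      if "i < M" "j < M" "i \<noteq> j" "0 < p" "p < Suc n" "0 < q" "q < Suc n" for i j p q
    proof -
      have ne: "C i \<noteq> C j"
        using inj_on_eq_iff[OF bij_betw_imp_inj_on[OF C], of i j] that by simp
      note p = LC[OF that(1,4,5)] and q = LC[OF that(2,6,7)]
      have xp: "(x, L i p) \<in> E" and xq: "(x, L j q) \<in> E"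
        using line_edge[OF Cl(1)[OF that(1)] Cl(2)[OF that(1)], of "L i p"]
          line_edge[OF Cl(1)[OF that(2)] Cl(2)[OF that(2)], of "L j q"] p q by auto
      have "L j q \<notin> C i"
        using line_eqI[OF Cl(1)[OF that(1)] Cl(1)[OF that(2)] Cl(2)[OF that(1)] Cl(2)[OF that(2)], of "L j q"]
          ne q by auto
      then show ?thesis
        using triangle_in_line[OF xp xq _ Cl(1)[OF that(1)] Cl(2)[OF that(1)]] p by auto
    qed
  qed
qed

theorem Hamming_structure:
  assumes \<theta>: "second_largest_eigenvalue X \<ge> (1 - \<epsilon>) * real (b 1)"
    and \<epsilon>: "\<epsilon> < 1 / (6 * m ^ 4 * real d)"
  obtains F M where "real M = m" "bij_betw F (words (Suc n) M) V"
    "\<And>ts x. ts \<in> words (Suc n) M \<Longrightarrow>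
      (F ts, x) \<in> E \<longleftrightarrow> (\<exists>i<M. \<exists>y<Suc n. y \<noteq> ts ! i \<and> x = F (ts[i := y]))"
proof -
  define \<theta>\<^sub>1 where "\<theta>\<^sub>1 = second_largest_eigenvalue X"
  have b0_pos: "real (b 0) > 0"
    using n_eq n_pos m_pos by (metis divide_eq_0_iff gr0I not_one_le_zero of_nat_0 of_nat_0_less_iff of_nat_eq_0_iff)
  let ?S = "adjacency_spectrum X - {Max (adjacency_spectrum X)}"
  \<comment> \<open>So the set is nonempty and its \<open>Max\<close> is attained.\<close>
  have "- m \<in> ?S"
    using smallest_in_spectrum m_pos b0_pos by (auto simp: Max_adjacency_spectrum)
  then have "\<theta>\<^sub>1 \<in> ?S"
    unfolding \<theta>\<^sub>1_def second_largest_eigenvalue_def using adjacency_spectrum_finite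
    by (intro Max_in) auto
  then have spec: "\<theta>\<^sub>1 \<in> adjacency_spectrum X" and lt: "\<theta>\<^sub>1 < b 0"
    using Max_ge[OF adjacency_spectrum_finite, of \<theta>\<^sub>1] by (auto simp: Max_adjacency_spectrum)
  obtain f where f: "eigenfunction \<theta>\<^sub>1 f" "\<exists>x\<in>V. f x \<noteq> 0"
    using spec by (auto simp: adjacency_spectrum_iff)
  obtain u :: "nat \<Rightarrow> real" and \<phi> :: "'a \<Rightarrow> 'a \<Rightarrow> real"
    where u: "u 0 = 1" "b 0 * u 1 = \<theta>\<^sub>1" "1 + a 1 * u 1 + b 1 * u 2 = \<theta>\<^sub>1 * u 1"
    and gram: "\<And>x y. x \<in> V \<Longrightarrow> y \<in> V \<Longrightarrow> (\<Sum>z\<in>V. \<phi> x z * \<phi> y z) = u (gdist x y)"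
    by (rule eigenvalue_representation[OF f d_ge_1]) (rule that)
  \<comment> \<open>Adjacent vertices have squared distance \<open>2 * \<delta>\<close>; dividing
    the vectors by \<open>sqrt \<delta>\<close> makes it 2.\<close>
  define \<delta> where "\<delta> = 1 - u 1"
  have "real (b 0) * u 1 < real (b 0) * 1"
    using lt u(2) by simp
  then have \<delta>: "\<delta> > 0"
    using b0_pos unfolding \<delta>_def mult_less_cancel_left_pos[OF b0_pos] by simp
  \<comment> \<open>Chosen so that the rescaled squared distance
    \<open>2 * (1 - u 2) / \<delta>\<close> at graph distance 2 is
    \<open>4 - 2 * \<eta>\<close>.\<close>
  define \<eta> where "\<eta> = 2 - (1 - u 2) / \<delta>"
  have b0: "real (b 0) = real (b 1) + real n"
    using b_1 by simp
  have b1: "real (b 1) > 0"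
    using b_1_pos by simp
  have "real (b 1) * (1 - u 2) = real (b 1) + 1 + (real n - 1) * u 1 - \<theta>\<^sub>1 * u 1"
    using u(3) a_1 n_pos by (simp add: algebra_simps of_nat_diff)
  \<comment> \<open>Substituting \<open>\<theta>\<^sub>1 = (b 1 + n) * u 1\<close> lets the factor
    \<open>1 - u 1\<close> split off.\<close>
  also have "\<dots> = \<delta> * (real (b 1) + \<theta>\<^sub>1 + 1)"
    unfolding \<delta>_def u(2)[symmetric] b0 by (simp add: algebra_simps)
  finally have "(1 - u 2) / \<delta> = (real (b 1) + \<theta>\<^sub>1 + 1) / real (b 1)"
    using \<delta> b1 by (simp add: field_simps)
  also have "\<dots> = 1 + (\<theta>\<^sub>1 + 1) / real (b 1)"
    using b1 by (simp add: field_simps)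
  finally have \<eta>_eq: "\<eta> = 1 - (\<theta>\<^sub>1 + 1) / real (b 1)"
    by (simp add: \<eta>_def)
  have "(1 - \<epsilon>) * real (b 1) \<le> \<theta>\<^sub>1 + 1"
    using \<theta> by (simp add: \<theta>\<^sub>1_def)
  then have "1 - \<epsilon> \<le> (\<theta>\<^sub>1 + 1) / real (b 1)"
    using b1 by (simp add: pos_le_divide_eq)
  then have "\<eta> \<le> \<epsilon>"
    using \<eta>_eq by simp
  define \<psi> where "\<psi> x z = \<phi> x z / sqrt \<delta>" for x z
  have norm: "(L2_set (\<lambda>z. \<psi> x z - \<psi> y z) V)\<^sup>2 = 2 * (1 - u (gdist x y)) / \<delta>"
    if "x \<in> V" "y \<in> V" for x y
  proof -
    have "(L2_set (\<lambda>z. \<psi> x z - \<psi> y z) V)\<^sup>2 = (\<Sum>z\<in>V. (\<psi> x z - \<psi> y z)\<^sup>2)"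
      by (rule L2_set_power2[OF V_finite])
    also have "\<dots> = (\<Sum>z\<in>V. (\<phi> x z * \<phi> x z + \<phi> y z * \<phi> y z - 2 * (\<phi> x z * \<phi> y z)) / \<delta>)"
      using \<delta> by (intro sum.cong refl)
        (simp add: \<psi>_def power2_eq_square algebra_simps flip: diff_divide_distrib add_divide_distrib)
    also have "\<dots> = (u (gdist x x) + u (gdist y y) - 2 * u (gdist x y)) / \<delta>"
      using gram that by (simp add: sum.distrib sum_subtractf flip: sum_divide_distrib sum_distrib_left)
    finally show ?thesis
      using that u(1) by simp
  qed
  have norm1: "(L2_set (\<lambda>z. \<psi> x z - \<psi> y z) V)\<^sup>2 = 2" if "(x, y) \<in> E" for x y
  proof -
    have "x \<in> V" "y \<in> V"
      using that E_in_V by blast+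
    moreover from this have "gdist x y = 1"
      using gdist_1_iff that by blast
    ultimately have "(L2_set (\<lambda>z. \<psi> x z - \<psi> y z) V)\<^sup>2 = 2 * \<delta> / \<delta>"
      using norm[of x y] by (simp add: \<delta>_def)
    then show ?thesis
      using \<delta> by simp
  qed
  have norm2: "(L2_set (\<lambda>z. \<psi> y z - \<psi> w z) V)\<^sup>2 = 4 - 2 * \<eta>"
    if "(x, y) \<in> E" "(x, w) \<in> E" "y \<noteq> w" "(y, w) \<notin> E" for x y w
  proof -
    have yw: "y \<in> V" "w \<in> V"
      using that E_in_V by blast+
    have "gdist y w = 2"
      using gdist_2_iff[OF yw] that E_sym by blast
    then show ?thesis
      using norm[OF yw] by (simp add: \<eta>_def)
  qed
  \<comment> \<open>On an induced quadrangle, \<open>4 * \<eta>\<close> is a squared norm.\<close>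
  have "\<eta> \<ge> 0"
  proof -
    obtain y z where yz: "y \<in> V" "z \<in> V" "gdist y z = 2"
      using distance_attained d_ge_2 by blast
    then obtain x where x: "y \<noteq> z" "(y, z) \<notin> E" "(x, y) \<in> E" "(x, z) \<in> E"
      using gdist_2_iff[OF yz(1,2)] E_sym by blast
    obtain w where w: "(y, w) \<in> E" "(z, w) \<in> E" "w \<noteq> x" "(x, w) \<notin> E"
      using fourth_vertex_exists[OF x(3,4,1,2)] by blast
    have wx: "(w, x) \<notin> E"
      using w(4) E_sym by blast
    have "0 \<le> (L2_set (\<lambda>i. (\<psi> w i - \<psi> y i) - (\<psi> z i - \<psi> x i)) V)\<^sup>2"
      by simp
    also have "\<dots> = 4 * \<eta>"
      unfolding L2_set_parallelogram[OF V_finite]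
      using norm1[OF E_sym[OF w(1)]] norm1[OF E_sym[OF w(2)]] norm1[OF E_sym[OF x(3)]] norm1[OF E_sym[OF x(4)]]
        norm2[OF w(1) E_sym[OF x(3)] w(3) wx] norm2[OF x(3,4,1,2)] by simp
    finally show ?thesis
      by simp
  qed
  obtain x\<^sub>0 where x0: "x\<^sub>0 \<in> V"
    using V_nonempty by blast
  obtain L :: "nat \<Rightarrow> nat \<Rightarrow> 'a" and M where M: "real M = m" and L: "\<And>i. i < M \<Longrightarrow> L i 0 = x\<^sub>0"
    "\<And>i p q. \<lbrakk>i < M; p < Suc n; q < Suc n; p \<noteq> q\<rbrakk> \<Longrightarrow> (L i p, L i q) \<in> E"
    "\<And>i j p q. \<lbrakk>i < M; j < M; i \<noteq> j; 0 < p; p < Suc n; 0 < q; q < Suc n\<rbrakk>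
      \<Longrightarrow> L i p \<noteq> L j q \<and> (L i p, L j q) \<notin> E"
    by (rule line_labelling[OF x0]) (rule that)
  have kM: "b 0 = M * n"
  proof -
    have "real (b 0) = real (M * n)"
      using n_eq m_pos M by simp
    then show ?thesis
      using of_nat_eq_iff by blast
  qed
  \<comment> \<open>With at most one line at a vertex, \<open>b 0 \<le> n\<close> would contradict
    \<open>b 1 > 0\<close>.\<close>
  have "M \<ge> 2"
  proof (rule ccontr)
    assume "\<not> M \<ge> 2"
    then have "M * n \<le> 1 * n"
      by (intro mult_right_mono) auto
    then have "real (b 0) \<le> real n"
      unfolding kM by (metis mult_1 of_nat_le_iff)
    then show False
      using b0 b1 by linarith
  qed
  interpret parallelogram_graph V E V \<psi> \<eta> M "Suc n" x\<^sub>0 L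
  proof (unfold_locales; (fact V_finite norm1 norm2 fourth_vertex_exists E_sym E_irrefl x0 L \<open>M \<ge> 2\<close> \<open>\<eta> \<ge> 0\<close>)?)
    show "E \<subseteq> V \<times> V"
      using E_in_V by auto
    show "0 < Suc n"
      by simp
    show "card {y. (x, y) \<in> E} = M * (Suc n - 1)" if "x \<in> V" for x
      using degree[OF that] kM by simp
    \<comment> \<open>The factor 6 in the bound for \<epsilon> together with
      \<open>d \<ge> 2\<close> yields the 12.\<close>
    have "12 * m ^ 4 * \<eta> \<le> 12 * m ^ 4 * (1 / (6 * m ^ 4 * real d))"
      using \<open>\<eta> \<le> \<epsilon>\<close> \<epsilon> m_pos by (intro mult_left_mono) auto
    also have "\<dots> = 2 / real d"
      using m_pos d_ge_2 by (simp add: field_simps)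
    also have "\<dots> \<le> 1"
      using d_ge_2 by simp
    finally show "12 * real M ^ 4 * \<eta> \<le> 1"
      by (simp add: M)
    show "S = V" if S: "S \<subseteq> V" "x\<^sub>0 \<in> S" "\<And>x y. x \<in> S \<Longrightarrow> (x, y) \<in> E \<Longrightarrow> y \<in> S" for S
    proof -
      have "\<forall>y\<in>V. gdist x\<^sub>0 y = l \<longrightarrow> y \<in> S" for l
      proof (induction l)
        case 0
        then show ?case
          using gdist_0D[OF x0] S(2) by auto
      next
        case (Suc l)
        then show ?case
          using gdist_pred[OF x0] S(3) by blast
      qed
      then show ?thesis
        using S(1) by blast
    qed
  qed
  show ?thesis
    by (rule Hamming_coordinates) (rule that[OF M])
qed

text \<open>Replacing letters one at a time bounds every distance by \<open>M\<close>. Conversely an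
  edge changes only one letter, so two words differing in all positions are at distance at least
  \<open>M\<close>.\<close>

theorem diameter_eq:
  assumes F: "bij_betw F (words (Suc n) M) V"
    and adj: "\<And>ts x. ts \<in> words (Suc n) M \<Longrightarrow>
      (F ts, x) \<in> E \<longleftrightarrow> (\<exists>i<M. \<exists>y<Suc n. y \<noteq> ts ! i \<and> x = F (ts[i := y]))"
  shows "d = M"
proof (rule antisym)
  let ?W = "words (Suc n) M"
  have FV: "F ts \<in> V" if "ts \<in> ?W" for ts
    using bij_betwE[OF F] that by blast
  obtain x y where xy: "x \<in> V" "y \<in> V" "gdist x y = d"
    using gdist_d_attained by blast
  then obtain ts us where ts: "ts \<in> ?W" "us \<in> ?W" "x = F ts" "y = F us"
    using bij_betw_imp_surj_on[OF F] by blast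
  have len: "length ts = M" "length us = M"
    using ts by (auto simp: words_def)
  have "gdist (F ts) (F (take l us @ drop l ts)) \<le> l" if "l \<le> M" for l
    using that
  proof (induction l)
    case 0
    then show ?case
      using FV ts by simp
  next
    case (Suc l)
    let ?w = "\<lambda>l. take l us @ drop l ts"
    have l: "l < M"
      using Suc by simp
    have w: "?w l \<in> ?W"
      using ts l by (auto simp: words_def dest: in_set_takeD in_set_dropD)
    have "drop l ts = ts ! l # drop (Suc l) ts"
      using l len by (simp add: Cons_nth_drop_Suc)
    then have w': "?w (Suc l) = (?w l)[l := us ! l]"
      using l len by (auto simp: take_Suc_conv_app_nth list_update_append)
    show ?case
    proof (cases "us ! l = ?w l ! l")
      case True
      then have "?w (Suc l) = ?w l"
        using w' by (metis list_update_id)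
      then show ?thesis
        using Suc by simp
    next
      case False
      then have "(F (?w l), F (?w (Suc l))) \<in> E"
        using adj[OF w] w' l words_nth[OF ts(2) l] by metis
      then show ?thesis
        using gdist_step[OF FV[OF ts(1)], of "F (?w l)" "F (?w (Suc l))"] Suc by simp
    qed
  qed
  from this[of M] show "d \<le> M"
    using ts xy len by simp
  have lower: "card {i. i < M \<and> ts ! i \<noteq> us ! i} \<le> gdist (F ts) (F us)"
    if ts: "ts \<in> ?W" and us: "us \<in> ?W" for ts us
    using us
  proof (induction "gdist (F ts) (F us)" arbitrary: us)
    case 0
    then have "F ts = F us"
      using gdist_0D FV ts by simp
    then have "ts = us"
      using bij_betw_imp_inj_on[OF F] ts 0 by (auto dest: inj_onD)
    then show ?case
      by simp
  next
    case (Suc l)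
    obtain z where z: "z \<in> V" "(z, F us) \<in> E" "gdist (F ts) z = l"
      using gdist_pred[OF FV[OF ts] FV[OF Suc.prems] Suc.hyps(2)[symmetric]] by blast
    then obtain ws where ws: "ws \<in> ?W" "z = F ws"
      using bij_betw_imp_surj_on[OF F] by blast
    obtain i y where iy: "i < M" "y < Suc n" "F us = F (ws[i := y])"
      using z(2) adj[OF ws(1)] ws(2) by blast
    then have "us = ws[i := y]"
      using bij_betw_imp_inj_on[OF F] Suc.prems words_update[OF ws(1) iy(2)] by (auto dest: inj_onD)
    then have "{j. j < M \<and> ts ! j \<noteq> us ! j} \<subseteq> insert i {j. j < M \<and> ts ! j \<noteq> ws ! j}"
      using nth_list_update_neq[of i _ ws y] by auto
    then have "card {j. j < M \<and> ts ! j \<noteq> us ! j} \<le> card (insert i {j. j < M \<and> ts ! j \<noteq> ws ! j})"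
      by (intro card_mono) auto
    also have "\<dots> \<le> Suc (card {j. j < M \<and> ts ! j \<noteq> ws ! j})"
      by (rule card_insert_le_m1) auto
    finally show ?case
      using Suc.hyps(1)[of ws] Suc.hyps(2) z(3) ws by simp
  qed
  \<comment> \<open>The letter 1 is available because \<open>n \<ge> 1\<close>.\<close>
  have r: "replicate M 0 \<in> ?W" "replicate M 1 \<in> ?W"
    using n_pos by (auto simp: words_def)
  have "{i. i < M \<and> replicate M (0::nat) ! i \<noteq> replicate M 1 ! i} = {..<M}"
    by auto
  then have "M \<le> gdist (F (replicate M 0)) (F (replicate M 1))"
    using lower[OF r] by simp
  also have "\<dots> \<le> d"
    using FV r by (intro gdist_le_d)
  finally show "M \<le> d" .
qed

end

section \<open>Isomorphism with the Hamming graph\<close>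

lemma digraph_iso_HammingI:
  assumes X: "pair_wf_digraph X"
    and F: "bij_betw F (words s d) (pverts X)"
    and adj: "\<And>ts x. ts \<in> words s d \<Longrightarrow>
      (F ts, x) \<in> parcs X \<longleftrightarrow> (\<exists>i<d. \<exists>y<s. y \<noteq> ts ! i \<and> x = F (ts[i := y]))"
  shows "digraph_iso (with_proj X) (with_proj (Hamming_graph d {..<s}))"
proof -
  interpret pair_wf_digraph X
    by (rule X)
  define g where "g = the_inv_into (words s d) F"
  have g: "bij_betw g (pverts X) (words s d)"
    unfolding g_def by (rule bij_betw_the_inv_into[OF F])
  have gF: "g (F ts) = ts" if "ts \<in> words s d" for ts
    unfolding g_def using F that by (simp add: bij_betw_def the_inv_into_f_f)
  have Fg: "F (g x) = x" if "x \<in> pverts X" for x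
    unfolding g_def using F that by (simp add: bij_betw_def f_the_inv_into_f)
  have gW: "g x \<in> words s d" if "x \<in> pverts X" for x
    using bij_betwE[OF g] that by blast
  have H: "Hamming_graph d {..<s} = \<lparr>pverts = words s d, parcs =
      {(ts, us). ts \<in> words s d \<and> us \<in> words s d \<and> (\<exists>!i. i < d \<and> ts ! i \<noteq> us ! i)}\<rparr>"
    by (auto simp: Hamming_graph_def words_def)
  \<comment> \<open>Matches the adjacency of \<open>Hamming_graph\<close> with the one-letter
    changes in \<open>adj\<close>.\<close>
  have ham: "(\<exists>!i. i < d \<and> ts ! i \<noteq> us ! i) \<longleftrightarrow> (\<exists>i<d. \<exists>y<s. y \<noteq> ts ! i \<and> us = ts[i := y])"
    if ts: "ts \<in> words s d" and us: "us \<in> words s d" for ts us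
  proof
    have len: "length ts = d" "length us = d"
      using ts us by (auto simp: words_def)
    assume ex1: "\<exists>!i. i < d \<and> ts ! i \<noteq> us ! i"
    then obtain i where i: "i < d" "ts ! i \<noteq> us ! i"
      by blast
    have uniq: "j = i" if "j < d" "ts ! j \<noteq> us ! j" for j
      using ex1 i that by blast
    have "us = ts[i := us ! i]"
    proof (rule nth_equalityI)
      fix j assume "j < length us"
      then have j: "j < d"
        using len by simp
      show "us ! j = ts[i := us ! i] ! j"
      proof (cases "j = i")
        case True
        then show ?thesis
          using i(1) len(1) by simp
      next
        case False
        then have "ts ! j = us ! j"
          using uniq[OF j] by blast
        then show ?thesis
          using False by simp
      qed
    qed (simp add: len)
    then show "\<exists>i<d. \<exists>y<s. y \<noteq> ts ! i \<and> us = ts[i := y]"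
      using i words_nth[OF us i(1)] by (intro exI[of _ i] exI[of _ "us ! i"] conjI) auto
  next
    assume "\<exists>i<d. \<exists>y<s. y \<noteq> ts ! i \<and> us = ts[i := y]"
    then obtain i y where "i < d" "y \<noteq> ts ! i" "us = ts[i := y]"
      by blast
    moreover have "length ts = d"
      using ts by (simp add: words_def)
    ultimately show "\<exists>!i. i < d \<and> ts ! i \<noteq> us ! i"
      by (intro ex1I[of _ i]) (auto simp: nth_list_update split: if_splits)
  qed
  have arcs: "map_prod g g ` parcs X = parcs (Hamming_graph d {..<s})"
  proof (intro equalityI subsetI)
    fix e assume "e \<in> map_prod g g ` parcs X"
    then obtain x y where xy: "(x, y) \<in> parcs X" "e = (g x, g y)"
      by auto
    then have V: "x \<in> pverts X" "y \<in> pverts X"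
      using in_arcsD1 in_arcsD2 by auto
    have "\<exists>i<d. \<exists>z<s. z \<noteq> g x ! i \<and> g y = (g x)[i := z]"
      using adj[OF gW[OF V(1)], of y] xy(1) Fg[OF V(1)] gF words_update[OF gW[OF V(1)]] by metis
    then show "e \<in> parcs (Hamming_graph d {..<s})"
      using ham[OF gW gW] V gW xy by (simp add: H)
  next
    fix e assume "e \<in> parcs (Hamming_graph d {..<s})"
    then obtain ts us where tu: "e = (ts, us)" "ts \<in> words s d" "us \<in> words s d"
      and "\<exists>!i. i < d \<and> ts ! i \<noteq> us ! i"
      unfolding H pair_pre_digraph.simps by blast
    then have "\<exists>i<d. \<exists>y<s. y \<noteq> ts ! i \<and> us = ts[i := y]"
      using ham[OF tu(2,3)] by blast
    then have "(F ts, F us) \<in> parcs X"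
      using adj[OF tu(2)] by blast
    then show "e \<in> map_prod g g ` parcs X"
      using gF tu by (intro image_eqI[of _ _ "(F ts, F us)"]) auto
  qed
  \<comment> \<open>Arcs are pairs, so the arc map is \<open>map_prod g g\<close> and the new tail
    and head functions are the projections.\<close>
  define hom where "hom = \<lparr>iso_verts = g, iso_arcs = map_prod g g, iso_head = snd, iso_tail = fst\<rparr>"
  have inj: "inj_on g (pverts X)"
    using g by (rule bij_betw_imp_inj_on)
  have "inj_on (map_prod g g) (parcs X)"
    by (rule inj_on_subset[OF map_prod_inj_on[OF inj inj]]) (auto dest: in_arcsD1 in_arcsD2)
  then have "pre_digraph.digraph_isomorphism (with_proj X) hom"
    using inj wf_digraph_axioms by (auto simp: digraph_isomorphism_def hom_def)
  moreover have "with_proj (Hamming_graph d {..<s}) = app_iso hom (with_proj X)"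
    using arcs bij_betw_imp_surj_on[OF g] by (simp add: app_iso_def hom_def with_proj_def H)
  ultimately show ?thesis
    unfolding digraph_iso_def by blast
qed

theorem theorem1p4:
  fixes X :: "'a pair_pre_digraph" and d k t :: nat and a b c :: "nat \<Rightarrow> nat"
    and m \<theta>\<^sub>1 \<epsilon> :: real and v :: 'a
  assumes "distance_regular_graph X d a b c"
    and "d \<ge> 2"
    and "k = b 0"
    and "geometric X k"
    and "smallest_eigenvalue X = - m"
    and "\<theta>\<^sub>1 = second_largest_eigenvalue X"
    and "c 2 \<ge> 2"
    and "\<theta>\<^sub>1 \<ge> (1 - \<epsilon>) * real (b 1)"
    and "0 < \<epsilon>" and "\<epsilon> < 1 / (6 * m ^ 4 * real d)"
    and "t \<le> d" and "real (c t) \<le> \<epsilon> * real k" and "real (b t) \<le> \<epsilon> * real k"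
    and "v \<in> pverts X" and "\<not> Digraph_Component.connected (neighborhood_graph X v)"
  shows "\<exists>s::nat. real s = 1 + real k / real d \<and>
    digraph_iso (with_proj X) (with_proj (Hamming_graph d {..<s}))"
proof -
  interpret distance_regular_graph X d a b c
    by fact
  obtain lines where Delsarte: "\<forall>C\<in>lines. Delsarte_clique X (b 0) C"
    and unique: "\<forall>(x, y) \<in> parcs X. \<exists>!C. C \<in> lines \<and> x \<in> C \<and> y \<in> C"
    using \<open>geometric X k\<close> \<open>k = b 0\<close> unfolding geometric_def by blast
  interpret geometric_drg X d a b c lines m
  proof
    show "d \<ge> 2" "smallest_eigenvalue X = - m"
      by fact+
    show "Delsarte_clique X (b 0) C" if "C \<in> lines" for C
      using Delsarte that by blast
    show "\<exists>!C. C \<in> lines \<and> x \<in> C \<and> y \<in> C" if "(x, y) \<in> parcs X" for x y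
      using bspec[OF unique that] by (simp only: prod.case)
  qed
  \<comment> \<open>The disconnected neighbourhood graph of \<open>v\<close> enters here, through
    \<open>line_single_neighbor\<close>.\<close>
  interpret disjoint_lines_drg X d a b c lines m
    by unfold_locales (fact line_single_neighbor[OF assms(14,15)] \<open>c 2 \<ge> 2\<close>)+
  obtain F M where M: "real M = m" and F: "bij_betw F (words (Suc n) M) (pverts X)"
    and adj: "\<And>ts x. ts \<in> words (Suc n) M \<Longrightarrow>
      (F ts, x) \<in> parcs X \<longleftrightarrow> (\<exists>i<M. \<exists>y<Suc n. y \<noteq> ts ! i \<and> x = F (ts[i := y]))"
    by (rule Hamming_structure[OF assms(8)[unfolded assms(6)] assms(10)]) (rule that)
  have "d = M"
    by (rule diameter_eq[OF F adj])
  \<comment> \<open>The witness is \<open>s = n + 1\<close>, the size of a line.\<close>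
  moreover have "real (Suc n) = 1 + real k / real M"
    using n_eq M \<open>k = b 0\<close> by simp
  moreover have "digraph_iso (with_proj X) (with_proj (Hamming_graph M {..<Suc n}))"
    by (rule digraph_iso_HammingI[OF pair_wf_digraph_axioms F adj])
  ultimately show ?thesis
    by blast
qed

end
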